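(* Let $(R,\mathfrak m,k)$ be a commutative local Noetherian ring, let $M$ be an $R$-module with minimal free resolution $G$, and let $R^!$ be the subalgebra of $\operatorname{Ext}_R(k,k)$ generated by $\operatorname{Ext}^1_R(k,k)$. Then the left $\operatorname{Ext}_R(k,k)$-action on $\operatorname{Hom}_k(\operatorname{Tor}^R(M,k),k)$ induced in homology by the left $\operatorname{Der}^\gamma_R(F)$-action $$(\theta\cdot\psi)(g\otimes f)=\theta(\psi(g\otimes f))-(-1)^{|\theta|(|\psi|+|g|)}\psi(g\otimes\theta(f))$$ on $\operatorname{Hom}_F(G\otimes_RF,F)$ restricts to the Herzog–Iyengar left $R^!$-action on $\operatorname{Hom}_k(\operatorname{Tor}^R(M,k),k)$.
   Context: Acyclic closure. $F$ denotes the acyclic closure of $k$ over $R$: the graded-commutative DG $R$-algebra $R\langle X\rangle$ with divided powers obtained from $R$ by Tate's process of successively adjoining, in each degree, a minimal set of exterior (odd degree) and divided power (even degree) variables killing homology, so that $F\to k$ is a quasi-isomorphism; it is a minimal free resolution of $k$. $\Gamma$-derivations. $\operatorname{Der}^\gamma_R(F)\subseteq\operatorname{End}_R(F)$ is the subcomplex of $\Gamma$-derivations: $R$-linear homogeneous maps $\theta$ with $\theta(ab)=\theta(a)b+(-1)^{|\theta||a|}a\theta(b)$ and $\theta(x^{(n)})=\theta(x)x^{(n-1)}$ for $x$ of even positive degree. It is a DG Lie algebra with $[\theta,\xi]=\theta\xi-(-1)^{|\theta||\xi|}\xi\theta$ and $\zeta^{[2]}=\zeta^2$ for $\zeta$ odd.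 The graded Lie $k$-algebra $\pi(R)=\mathrm H(\operatorname{Der}^\gamma_R(F))$ has universal enveloping algebra $U\pi(R)\cong\operatorname{Ext}_R(k,k)$. The left Lie action of $\pi(R)$ is extended to $\operatorname{Ext}_R(k,k)$ through this isomorphism, and it is transported to $\operatorname{Hom}_k(\operatorname{Tor}^R(M,k),k)$ through $\mathrm H(\operatorname{Hom}_F(G\otimes_RF,F))\cong\mathrm H(\operatorname{Hom}_F(G\otimes_RF,k))\cong\operatorname{Hom}_k(\operatorname{Tor}^R(M,k),k)$, where the first isomorphism is induced by the augmentation $F\to k$. Herzog–Iyengar action. Let $r_1,\dots,r_e$ be a minimal generating set of $\mathfrak m$, let $x_1,\dots,x_e$ be the degree-one variables of $F$ with $\partial(x_i)=r_i$, and let $y_1,\dots,y_e$ be the corresponding $k$-basis of $\operatorname{Ext}^1_R(k,k)$, namely $y_i=[\theta_i]$ with $\theta_i\in\operatorname{Der}^\gamma_R(F)$ a cycle of homological degree $-1$ such that $\theta_i(x_j)=\delta_{ij}$; these generate $R^!$. Since $G$ is minimal, $\operatorname{Tor}^R(M,k)=G\otimes_Rk$; write $\bar z$ for the image of $z\in G$ in $G\otimes_R k$. The right $R^!$-module structure on $\operatorname{Hom}_k(\operatorname{Tor}^R(M,k),k)$ is determined as follows: for $\alpha\in\operatorname{Hom}_k(\operatorname{Tor}^R_{n-1}(M,k),k)$ (of degree $|\alpha|=1-n$) and $z\in G_n$ with $\partial(z)=\sum_{j=1}^er_jf_j$, $f_j\in G_{n-1}$, one sets $(\alpha\cdot y_i)(\bar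 z)=-\alpha(\bar f_i)$. The left $R^!$-action is obtained by twisting with the antipode: $y_i\cdot\alpha:=-(-1)^{|\alpha|}\alpha\cdot y_i$. *)

theory Defs
  imports
    Complex_Main
    "HOL-Library.Function_Algebras"
    "HOL-Library.Set_Algebras"
    "HOL-Library.Poly_Mapping"
begin

section \<open>Local rings\<close>

text \<open>Ideals of the ring are the submodules of the ring over itself.\<close>

definition local_noetherian_ring :: "'r::comm_ring_1 set \<Rightarrow> bool" where
  "local_noetherian_ring mm \<longleftrightarrow>
     module.subspace (*) mm \<and> mm \<noteq> UNIV \<and>
     (\<forall>I. module.subspace (*) I \<and> I \<noteq> UNIV \<longrightarrow> I \<subseteq> mm) \<and>
     (\<forall>I :: 'r set. module.subspace (*) I \<longrightarrow> (\<exists>S. finite S \<and> I = module.span (*) S))"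

text \<open>The residue field is a field together with the projection from the ring onto it.\<close>

definition residue_field :: "'r::comm_ring_1 set \<Rightarrow> ('r \<Rightarrow> 'k::field) \<Rightarrow> bool" where
  "residue_field mm eps \<longleftrightarrow>
     eps 1 = 1 \<and> (\<forall>a b. eps (a + b) = eps a + eps b) \<and> (\<forall>a b. eps (a * b) = eps a * eps b) \<and>
     surj eps \<and> {a. eps a = 0} = mm"

definition minimal_generators :: "'r::comm_ring_1 set \<Rightarrow> nat \<Rightarrow> (nat \<Rightarrow> 'r) \<Rightarrow> bool" where
  "minimal_generators mm e r \<longleftrightarrow>
     module.span (*) (r ` {1..e}) = mm \<and>
     (\<forall>I. I \<subset> {1..e} \<longrightarrow> module.span (*) (r ` I) \<noteq> mm)"

section \<open>Graded modules and complexes\<close>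

text \<open>The sign \<open>(-1)^n\<close> acting on an additive group.\<close>

definition ksign :: "int \<Rightarrow> 'a::ab_group_add \<Rightarrow> 'a" where
  "ksign n a = (if even n then a else - a)"

text \<open>
  A complex is represented by its total module (the direct sum of its components), which is the
  whole type \<open>'a\<close>; \<open>gr n\<close> is the component in homological degree \<open>n\<close>, and \<open>bd\<close> the differential.
\<close>

record ('r, 'a) complex_data =
  scal :: "'r \<Rightarrow> 'a \<Rightarrow> 'a"
  gr :: "int \<Rightarrow> 'a set"
  bd :: "'a \<Rightarrow> 'a"

definition nonneg_complex ::
  "('r::comm_ring_1, 'a::ab_group_add, 'z) complex_data_scheme \<Rightarrow> bool" where
  "nonneg_complex C \<longleftrightarrow>
     module (scal C) \<and>
     (\<forall>n. module.subspace (scal C) (gr C n)) \<and>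
     (\<forall>n<0. gr C n = {0}) \<and>
     (\<forall>a. \<exists>!c. (\<forall>n. c n \<in> gr C n) \<and> finite {n. c n \<noteq> 0} \<and> a = (\<Sum>n | c n \<noteq> 0. c n)) \<and>
     module_hom (scal C) (scal C) (bd C) \<and>
     (\<forall>n. bd C ` gr C n \<subseteq> gr C (n - 1)) \<and>
     (\<forall>a. bd C (bd C a) = 0)"

definition free_submodule ::
  "('r::comm_ring_1 \<Rightarrow> 'a::ab_group_add \<Rightarrow> 'a) \<Rightarrow> 'a set \<Rightarrow> bool" where
  "free_submodule s U \<longleftrightarrow> (\<exists>B. \<not> module.dependent s B \<and> module.span s B = U)"

text \<open>The module \<open>M\<close> is the whole type \<open>'m\<close> with scalar multiplication \<open>sM\<close>; \<open>eta\<close> is the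
  augmentation \<open>G \<rightarrow> M\<close>.\<close>

definition minimal_free_resolution ::
  "'r::comm_ring_1 set \<Rightarrow> ('r \<Rightarrow> 'm::ab_group_add \<Rightarrow> 'm) \<Rightarrow>
   ('r, 'g::ab_group_add, 'z) complex_data_scheme \<Rightarrow> ('g \<Rightarrow> 'm) \<Rightarrow> bool" where
  "minimal_free_resolution mm sM G eta \<longleftrightarrow>
     nonneg_complex G \<and>
     (\<forall>n. free_submodule (scal G) (gr G n)) \<and>
     module_hom (scal G) sM eta \<and>
     (\<forall>n. n \<noteq> 0 \<longrightarrow> eta ` gr G n \<subseteq> {0}) \<and>
     eta ` gr G 0 = UNIV \<and>
     {z \<in> gr G 0. eta z = 0} = bd G ` gr G 1 \<and>
     (\<forall>n>0. {z \<in> gr G n. bd G z = 0} = bd G ` gr G (n + 1)) \<and>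
     range (bd G) \<subseteq> module.span (scal G) {scal G a z | a z. a \<in> mm}"

section \<open>DG algebras with divided powers and the acyclic closure\<close>

text \<open>
  \<open>dpow n a\<close> is the divided power \<open>a\<^sup>(\<^sup>n\<^sup>)\<close>, meaningful for \<open>a\<close> homogeneous of even positive degree.
  \<open>Vars\<close> indexes the adjoined variables, \<open>vdeg v\<close> is the degree of the variable \<open>var v\<close>.
\<close>

record ('r, 'a, 'v) gamma_data = "('r, 'a) complex_data" +
  dpow :: "nat \<Rightarrow> 'a \<Rightarrow> 'a"
  Vars :: "'v set"
  vdeg :: "'v \<Rightarrow> nat"
  var :: "'v \<Rightarrow> 'a"

definition dg_algebra ::
  "('r::comm_ring_1, 'f::ring_1, 'z) complex_data_scheme \<Rightarrow> bool" where
  "dg_algebra F \<longleftrightarrow>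
     nonneg_complex F \<and>
     (\<forall>r a b. scal F r (a * b) = scal F r a * b \<and> scal F r (a * b) = a * scal F r b) \<and>
     1 \<in> gr F 0 \<and>
     (\<forall>i j a b. a \<in> gr F i \<and> b \<in> gr F j \<longrightarrow>
        a * b \<in> gr F (i + j) \<and> a * b = ksign (i * j) (b * a)) \<and>
     (\<forall>i a. odd i \<and> a \<in> gr F i \<longrightarrow> a * a = 0) \<and>
     (\<forall>i a b. a \<in> gr F i \<longrightarrow> bd F (a * b) = bd F a * b + ksign i (a * bd F b))"

definition divided_powers ::
  "('r::comm_ring_1, 'f::ring_1, 'v, 'z) gamma_data_scheme \<Rightarrow> bool" where
  "divided_powers F \<longleftrightarrow>
     (\<forall>m a. even m \<and> m > 0 \<and> a \<in> gr F m \<longrightarrow>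
        dpow F 0 a = 1 \<and> dpow F 1 a = a \<and>
        (\<forall>i. dpow F i a \<in> gr F (int i * m)) \<and>
        (\<forall>i j. dpow F i a * dpow F j a = of_nat ((i + j) choose i) * dpow F (i + j) a) \<and>
        (\<forall>b n. b \<in> gr F m \<longrightarrow> dpow F n (a + b) = (\<Sum>i\<le>n. dpow F i a * dpow F (n - i) b)) \<and>
        (\<forall>l b n. even l \<and> b \<in> gr F l \<longrightarrow> dpow F n (b * a) = b ^ n * dpow F n a) \<and>
        (\<forall>i j. j > 0 \<longrightarrow>
           dpow F i (dpow F j a) =
             of_nat (fact (i * j) div (fact i * fact j ^ i)) * dpow F (i * j) a) \<and>
        (\<forall>n>0. bd F (dpow F n a) = bd F a * dpow F (n - 1) a)) \<and>
     (\<forall>i j a b n. odd i \<and> odd j \<and> a \<in> gr F i \<and> b \<in> gr F j \<and> n \<ge> 2 \<longrightarrow> dpow F n (a * b) = 0)"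

text \<open>Exponent vectors of the normal monomials: finitely supported, at most \<open>1\<close> at variables of odd
  degree.  The linear order on the index type only fixes the order of the factors.\<close>

definition exponents :: "('r, 'f, 'v, 'z) gamma_data_scheme \<Rightarrow> ('v \<Rightarrow> nat) set" where
  "exponents F = {a. finite {v. a v \<noteq> 0} \<and> {v. a v \<noteq> 0} \<subseteq> Vars F \<and>
     (\<forall>v. odd (vdeg F v) \<longrightarrow> a v \<le> 1)}"

definition monomial ::
  "('r, 'f::ring_1, 'v::linorder, 'z) gamma_data_scheme \<Rightarrow> ('v \<Rightarrow> nat) \<Rightarrow> 'f" where
  "monomial F a = prod_list (map
     (\<lambda>v. if odd (vdeg F v) then var F v else dpow F (a v) (var F v))
     (sorted_list_of_set {v. a v \<noteq> 0}))"

text \<open>\<open>upto_subalgebra F n\<close> is \<open>R\<langle>X\<^sub>\<le>\<^sub>n\<rangle>\<close>.\<close>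

definition upto_subalgebra ::
  "('r::comm_ring_1, 'f::ring_1, 'v::linorder, 'z) gamma_data_scheme \<Rightarrow> nat \<Rightarrow> 'f set" where
  "upto_subalgebra F n = module.span (scal F)
     (monomial F ` {a \<in> exponents F. \<forall>v. a v \<noteq> 0 \<longrightarrow> vdeg F v \<le> n})"

text \<open>
  The cycles to be killed by the variables of degree \<open>n + 1\<close>: for \<open>n = 0\<close> the maximal ideal, i.e.\ the
  kernel of \<open>R \<rightarrow> k\<close>, and for \<open>n > 0\<close> the degree \<open>n\<close> cycles of \<open>R\<langle>X\<^sub>\<le>\<^sub>n\<rangle>\<close>.
\<close>

definition cycles_to_kill ::
  "'r set \<Rightarrow> ('r::comm_ring_1, 'f::ring_1, 'v::linorder, 'z) gamma_data_scheme \<Rightarrow> nat \<Rightarrow> 'f set" where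
  "cycles_to_kill mm F n =
     (if n = 0 then {scal F a 1 | a. a \<in> mm}
      else {z \<in> upto_subalgebra F n \<inter> gr F (int n). bd F z = 0})"

definition upto_boundaries ::
  "('r::comm_ring_1, 'f::ring_1, 'v::linorder, 'z) gamma_data_scheme \<Rightarrow> nat \<Rightarrow> 'f set" where
  "upto_boundaries F n = bd F ` (upto_subalgebra F n \<inter> gr F (int n + 1))"

text \<open>
  The last clause says that, for every \<open>n\<close>, the homology classes of \<open>\<partial>x\<close>, for \<open>x\<close> in \<open>X\<^sub>n\<^sub>+\<^sub>1\<close>,
  form a minimal generating set of \<open>H\<^sub>n(R\<langle>X\<^sub>\<le>\<^sub>n\<rangle>)\<close> (of the maximal ideal if \<open>n = 0\<close>).
\<close>

definition acyclic_closure ::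
  "'r set \<Rightarrow> ('r::comm_ring_1, 'f::ring_1, 'v::linorder, 'z) gamma_data_scheme \<Rightarrow> bool" where
  "acyclic_closure mm F \<longleftrightarrow>
     dg_algebra F \<and> divided_powers F \<and>
     (\<forall>v\<in>Vars F. vdeg F v > 0 \<and> var F v \<in> gr F (int (vdeg F v))) \<and>
     inj_on (monomial F) (exponents F) \<and>
     \<not> module.dependent (scal F) (monomial F ` exponents F) \<and>
     module.span (scal F) (monomial F ` exponents F) = UNIV \<and>
     (\<forall>n. let W = {v \<in> Vars F. vdeg F v = Suc n};
              gen = (\<lambda>W'. module.span (scal F) ((\<lambda>v. bd F (var F v)) ` W' \<union> upto_boundaries F n))
          in gen W = cycles_to_kill mm F n \<and> (\<forall>W'. W' \<subset> W \<longrightarrow> gen W' \<noteq> cycles_to_kill mm F n))"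

definition augmentation ::
  "('r::comm_ring_1 \<Rightarrow> 'k::field) \<Rightarrow> ('r, 'f::ring_1, 'z) complex_data_scheme \<Rightarrow> ('f \<Rightarrow> 'k) \<Rightarrow> bool" where
  "augmentation eps F aug \<longleftrightarrow>
     (\<forall>a b. aug (a + b) = aug a + aug b) \<and>
     (\<forall>r. aug (scal F r 1) = eps r) \<and>
     (\<forall>n. n \<noteq> 0 \<longrightarrow> aug ` gr F n \<subseteq> {0})"

section \<open>The algebra of self-extensions of the residue field\<close>

text \<open>\<open>Ext\<^sub>R(k,k)\<close> is the homology algebra of \<open>End\<^sub>R(F)\<close>, whose elements are finite sums of homogeneous
  linear maps.  Degrees are homological: \<open>Ext\<^sup>1\<close> sits in degree \<open>-1\<close>.\<close>

definition end_maps ::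
  "('r::comm_ring_1, 'f::ab_group_add, 'z) complex_data_scheme \<Rightarrow> int \<Rightarrow> ('f \<Rightarrow> 'f) set" where
  "end_maps F d = {\<phi>. module_hom (scal F) (scal F) \<phi> \<and> (\<forall>n. \<phi> ` gr F n \<subseteq> gr F (n + d))}"

definition end_diff ::
  "('r, 'f::ab_group_add, 'z) complex_data_scheme \<Rightarrow> int \<Rightarrow> ('f \<Rightarrow> 'f) \<Rightarrow> 'f \<Rightarrow> 'f" where
  "end_diff F d \<phi> = (\<lambda>a. bd F (\<phi> a) - ksign d (\<phi> (bd F a)))"

definition end_cycles ::
  "('r::comm_ring_1, 'f::ab_group_add, 'z) complex_data_scheme \<Rightarrow> int \<Rightarrow> ('f \<Rightarrow> 'f) set" where
  "end_cycles F d = {\<phi> \<in> end_maps F d. end_diff F d \<phi> = 0}"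

text \<open>All boundaries, that is, finite sums of homogeneous ones.\<close>

definition end_boundaries ::
  "('r::comm_ring_1, 'f::ab_group_add, 'z) complex_data_scheme \<Rightarrow> ('f \<Rightarrow> 'f) set" where
  "end_boundaries F = module.span (\<lambda>r \<phi> a. scal F r (\<phi> a))
     (\<Union>d. end_diff F d ` end_maps F d)"

definition end_class ::
  "('r::comm_ring_1, 'f::ab_group_add, 'z) complex_data_scheme \<Rightarrow> ('f \<Rightarrow> 'f) \<Rightarrow> ('f \<Rightarrow> 'f) set" where
  "end_class F \<phi> = \<phi> +o end_boundaries F"

definition ext_deg ::
  "('r::comm_ring_1, 'f::ab_group_add, 'z) complex_data_scheme \<Rightarrow> int \<Rightarrow> ('f \<Rightarrow> 'f) set set" where
  "ext_deg F d = end_class F ` end_cycles F d"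

definition ext_alg ::
  "('r::comm_ring_1, 'f::ab_group_add, 'z) complex_data_scheme \<Rightarrow> ('f \<Rightarrow> 'f) set set" where
  "ext_alg F = end_class F `
     module.span (\<lambda>r \<phi> a. scal F r (\<phi> a)) (\<Union>d. end_cycles F d)"

text \<open>Sums of classes are sums of sets (theory \<open>Set_Algebras\<close>); products are induced by composition.\<close>

definition ext_mult ::
  "('r::comm_ring_1, 'f::ab_group_add, 'z) complex_data_scheme \<Rightarrow>
   ('f \<Rightarrow> 'f) set \<Rightarrow> ('f \<Rightarrow> 'f) set \<Rightarrow> ('f \<Rightarrow> 'f) set" where
  "ext_mult F X Y = {\<phi> \<circ> \<psi> | \<phi> \<psi>. \<phi> \<in> X \<and> \<psi> \<in> Y} + end_boundaries F"

definition ext_scalar ::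
  "('r::comm_ring_1, 'f::ab_group_add, 'z) complex_data_scheme \<Rightarrow> 'r \<Rightarrow> ('f \<Rightarrow> 'f) set" where
  "ext_scalar F a = end_class F (scal F a)"

text \<open>\<open>R\<^sup>!\<close>, the \<open>k\<close>-subalgebra generated by \<open>Ext\<^sup>1\<close>.\<close>

inductive_set ext_shriek ::
  "('r::comm_ring_1, 'f::ab_group_add, 'z) complex_data_scheme \<Rightarrow> ('f \<Rightarrow> 'f) set set"
  for F where
  scalar: "ext_scalar F a \<in> ext_shriek F"
| gen: "X \<in> ext_deg F (-1) \<Longrightarrow> X \<in> ext_shriek F"
| add: "X \<in> ext_shriek F \<Longrightarrow> Y \<in> ext_shriek F \<Longrightarrow> X + Y \<in> ext_shriek F"
| mult: "X \<in> ext_shriek F \<Longrightarrow> Y \<in> ext_shriek F \<Longrightarrow> ext_mult F X Y \<in> ext_shriek F"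

section \<open>Gamma-derivations and the homotopy Lie algebra\<close>

definition gamma_derivations ::
  "('r::comm_ring_1, 'f::ring_1, 'v, 'z) gamma_data_scheme \<Rightarrow> int \<Rightarrow> ('f \<Rightarrow> 'f) set" where
  "gamma_derivations F d = {\<theta> \<in> end_maps F d.
     (\<forall>i a b. a \<in> gr F i \<longrightarrow> \<theta> (a * b) = \<theta> a * b + ksign (d * i) (a * \<theta> b)) \<and>
     (\<forall>m a n. even m \<and> m > 0 \<and> a \<in> gr F m \<and> n > 0 \<longrightarrow>
        \<theta> (dpow F n a) = \<theta> a * dpow F (n - 1) a)}"

definition der_cycles ::
  "('r::comm_ring_1, 'f::ring_1, 'v, 'z) gamma_data_scheme \<Rightarrow> int \<Rightarrow> ('f \<Rightarrow> 'f) set" where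
  "der_cycles F d = {\<theta> \<in> gamma_derivations F d. end_diff F d \<theta> = 0}"

text \<open>The degree \<open>d\<close> part of \<open>\<pi>(R) = H(Der\<^sup>\<gamma>\<^sub>R(F))\<close>.  If \<open>\<xi>\<close> is the class of \<open>\<theta>\<close> in it, then
  \<open>\<xi> + end_boundaries F\<close> is the class of \<open>\<theta>\<close> in \<open>Ext\<^sub>R(k,k)\<close>.\<close>

definition homotopy_lie ::
  "('r::comm_ring_1, 'f::ring_1, 'v, 'z) gamma_data_scheme \<Rightarrow> int \<Rightarrow> ('f \<Rightarrow> 'f) set set" where
  "homotopy_lie F d =
     (\<lambda>\<theta>. \<theta> +o end_diff F (d + 1) ` gamma_derivations F (d + 1)) ` der_cycles F d"

section \<open>Tensor products\<close>

text \<open>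
  The tensor product of two \<open>R\<close>-modules is the quotient of the free \<open>R\<close>-module on pairs by the
  bilinearity relations; its elements are cosets.
\<close>

definition tensor_null ::
  "('r::comm_ring_1 \<Rightarrow> 'a::ab_group_add \<Rightarrow> 'a) \<Rightarrow> ('r \<Rightarrow> 'b::ab_group_add \<Rightarrow> 'b) \<Rightarrow>
   ('a \<times> 'b \<Rightarrow>\<^sub>0 'r) set" where
  "tensor_null sa sb = module.span (\<lambda>r. Poly_Mapping.map ((*) r))
     ({Poly_Mapping.single (a + a', b) 1 - Poly_Mapping.single (a, b) 1
         - Poly_Mapping.single (a', b) 1 | a a' b. True} \<union>
      {Poly_Mapping.single (a, b + b') 1 - Poly_Mapping.single (a, b) 1
         - Poly_Mapping.single (a, b') 1 | a b b'. True} \<union>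
      {Poly_Mapping.single (sa r a, b) 1 - Poly_Mapping.single (a, b) r | r a b. True} \<union>
      {Poly_Mapping.single (a, sb r b) 1 - Poly_Mapping.single (a, b) r | r a b. True})"

definition tensor_carrier ::
  "('r::comm_ring_1 \<Rightarrow> 'a::ab_group_add \<Rightarrow> 'a) \<Rightarrow> ('r \<Rightarrow> 'b::ab_group_add \<Rightarrow> 'b) \<Rightarrow>
   ('a \<times> 'b \<Rightarrow>\<^sub>0 'r) set set" where
  "tensor_carrier sa sb = range (\<lambda>p. p +o tensor_null sa sb)"

definition pure_tensor ::
  "('r::comm_ring_1 \<Rightarrow> 'a::ab_group_add \<Rightarrow> 'a) \<Rightarrow> ('r \<Rightarrow> 'b::ab_group_add \<Rightarrow> 'b) \<Rightarrow>
   'a \<Rightarrow> 'b \<Rightarrow> ('a \<times> 'b \<Rightarrow>\<^sub>0 'r) set" where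
  "pure_tensor sa sb a b = Poly_Mapping.single (a, b) 1 +o tensor_null sa sb"

section \<open>The dual of Tor\<close>

text \<open>As \<open>G\<close> is minimal, \<open>Tor\<^sup>R(M,k)\<close> is \<open>G \<otimes>\<^sub>R k\<close>; the field \<open>k\<close> is an \<open>R\<close>-module through \<open>eps\<close>.\<close>

definition tor ::
  "('r::comm_ring_1 \<Rightarrow> 'k::field) \<Rightarrow> ('r, 'g::ab_group_add, 'z) complex_data_scheme \<Rightarrow>
   ('g \<times> 'k \<Rightarrow>\<^sub>0 'r) set set" where
  "tor eps G = tensor_carrier (scal G) (\<lambda>r c. eps r * c)"

definition tor_tensor ::
  "('r::comm_ring_1 \<Rightarrow> 'k::field) \<Rightarrow> ('r, 'g::ab_group_add, 'z) complex_data_scheme \<Rightarrow>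
   'g \<Rightarrow> 'k \<Rightarrow> ('g \<times> 'k \<Rightarrow>\<^sub>0 'r) set" where
  "tor_tensor eps G = pure_tensor (scal G) (\<lambda>r c. eps r * c)"

text \<open>The image \<open>z \<otimes> 1\<close> of \<open>z\<close> in \<open>G \<otimes>\<^sub>R k\<close>.\<close>

definition tor_bar ::
  "('r::comm_ring_1 \<Rightarrow> 'k::field) \<Rightarrow> ('r, 'g::ab_group_add, 'z) complex_data_scheme \<Rightarrow>
   'g \<Rightarrow> ('g \<times> 'k \<Rightarrow>\<^sub>0 'r) set" where
  "tor_bar eps G z = tor_tensor eps G z 1"

text \<open>Functionals are set to \<open>0\<close> outside \<open>Tor\<close>, so that they are determined by their values there.\<close>

definition tor_functionals ::
  "('r::comm_ring_1 \<Rightarrow> 'k::field) \<Rightarrow> ('r, 'g::ab_group_add, 'z) complex_data_scheme \<Rightarrow>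
   (('g \<times> 'k \<Rightarrow>\<^sub>0 'r) set \<Rightarrow> 'k) set" where
  "tor_functionals eps G = {\<alpha>.
     (\<forall>s\<in>tor eps G. \<forall>t\<in>tor eps G. \<alpha> (s + t) = \<alpha> s + \<alpha> t) \<and>
     (\<forall>z c c'. \<alpha> (tor_tensor eps G z (c * c')) = c * \<alpha> (tor_tensor eps G z c')) \<and>
     (\<forall>t. t \<notin> tor eps G \<longrightarrow> \<alpha> t = 0)}"

text \<open>The part of degree \<open>d\<close> is \<open>Hom\<^sub>k(Tor\<^sub>-\<^sub>d, k)\<close>, and the graded dual is the direct sum of these.\<close>

definition tor_dual_deg ::
  "('r::comm_ring_1 \<Rightarrow> 'k::field) \<Rightarrow> ('r, 'g::ab_group_add, 'z) complex_data_scheme \<Rightarrow>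
   int \<Rightarrow> (('g \<times> 'k \<Rightarrow>\<^sub>0 'r) set \<Rightarrow> 'k) set" where
  "tor_dual_deg eps G d = {\<alpha> \<in> tor_functionals eps G.
     \<forall>n z. n + d \<noteq> 0 \<and> z \<in> gr G n \<longrightarrow> \<alpha> (tor_bar eps G z) = 0}"

definition tor_dual ::
  "('r::comm_ring_1 \<Rightarrow> 'k::field) \<Rightarrow> ('r, 'g::ab_group_add, 'z) complex_data_scheme \<Rightarrow>
   (('g \<times> 'k \<Rightarrow>\<^sub>0 'r) set \<Rightarrow> 'k) set" where
  "tor_dual eps G = {\<alpha> \<in> tor_functionals eps G.
     finite {n. \<exists>z\<in>gr G n. \<alpha> (tor_bar eps G z) \<noteq> 0}}"

section \<open>The action of derivations\<close>

definition GF_tensor ::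
  "('r::comm_ring_1, 'g::ab_group_add, 'y) complex_data_scheme \<Rightarrow>
   ('r, 'f::ab_group_add, 'z) complex_data_scheme \<Rightarrow> 'g \<Rightarrow> 'f \<Rightarrow> ('g \<times> 'f \<Rightarrow>\<^sub>0 'r) set" where
  "GF_tensor G F = pure_tensor (scal G) (scal F)"

text \<open>
  Elements of degree \<open>d\<close> in \<open>Hom\<^sub>F(G \<otimes>\<^sub>R F, F)\<close>.  The action of \<open>F\<close> on \<open>G \<otimes>\<^sub>R F\<close> is written on the
  right, \<open>(g \<otimes> f)f' = g \<otimes> ff'\<close>; for graded-commutative \<open>F\<close>, linearity for this action is the same
  as linearity, with signs, for the corresponding left action.
\<close>

definition homF ::
  "('r::comm_ring_1, 'g::ab_group_add, 'y) complex_data_scheme \<Rightarrow>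
   ('r, 'f::ring_1, 'z) complex_data_scheme \<Rightarrow> int \<Rightarrow> (('g \<times> 'f \<Rightarrow>\<^sub>0 'r) set \<Rightarrow> 'f) set" where
  "homF G F d = {\<psi>.
     (\<forall>s\<in>tensor_carrier (scal G) (scal F). \<forall>t\<in>tensor_carrier (scal G) (scal F).
        \<psi> (s + t) = \<psi> s + \<psi> t) \<and>
     (\<forall>g f f'. \<psi> (GF_tensor G F g (f * f')) = \<psi> (GF_tensor G F g f) * f') \<and>
     (\<forall>i j g f. g \<in> gr G i \<and> f \<in> gr F j \<longrightarrow> \<psi> (GF_tensor G F g f) \<in> gr F (i + j + d))}"

text \<open>The cycle condition is \<open>\<partial>\<psi> = (-1)\<^sup>d\<psi>\<partial>\<close>, with
  \<open>\<partial>(g \<otimes> f) = \<partial>g \<otimes> f + (-1)\<^sup>i g \<otimes> \<partial>f\<close> for \<open>g\<close> of degree \<open>i\<close>.\<close>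

definition homF_cycles ::
  "('r::comm_ring_1, 'g::ab_group_add, 'y) complex_data_scheme \<Rightarrow>
   ('r, 'f::ring_1, 'z) complex_data_scheme \<Rightarrow> int \<Rightarrow> (('g \<times> 'f \<Rightarrow>\<^sub>0 'r) set \<Rightarrow> 'f) set" where
  "homF_cycles G F d = {\<psi> \<in> homF G F d.
     \<forall>i g f. g \<in> gr G i \<longrightarrow>
       bd F (\<psi> (GF_tensor G F g f)) =
       ksign d (\<psi> (GF_tensor G F (bd G g) f) + ksign i (\<psi> (GF_tensor G F g (bd F f))))}"

text \<open>\<open>\<chi>\<close> is \<open>\<theta>\<cdot>\<psi>\<close>, where \<open>d\<close> and \<open>m\<close> are the degrees of \<open>\<theta>\<close> and \<open>\<psi>\<close>.\<close>

definition is_der_action ::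
  "('r::comm_ring_1, 'g::ab_group_add, 'y) complex_data_scheme \<Rightarrow>
   ('r, 'f::ring_1, 'z) complex_data_scheme \<Rightarrow> int \<Rightarrow> ('f \<Rightarrow> 'f) \<Rightarrow>
   int \<Rightarrow> (('g \<times> 'f \<Rightarrow>\<^sub>0 'r) set \<Rightarrow> 'f) \<Rightarrow> (('g \<times> 'f \<Rightarrow>\<^sub>0 'r) set \<Rightarrow> 'f) \<Rightarrow> bool" where
  "is_der_action G F d \<theta> m \<psi> \<chi> \<longleftrightarrow>
     \<chi> \<in> homF G F (d + m) \<and>
     (\<forall>i g f. g \<in> gr G i \<longrightarrow>
        \<chi> (GF_tensor G F g f) =
        \<theta> (\<psi> (GF_tensor G F g f)) - ksign (d * (m + i)) (\<psi> (GF_tensor G F g (\<theta> f))))"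

text \<open>
  The class of \<open>\<psi>\<close> corresponds to \<open>\<alpha>\<close> under the isomorphisms
  \<open>H(Hom\<^sub>F(G \<otimes>\<^sub>R F, F)) \<cong> H(Hom\<^sub>F(G \<otimes>\<^sub>R F, k)) \<cong> Hom\<^sub>k(Tor\<^sup>R(M,k), k)\<close>: compose with the
  augmentation and restrict along \<open>G \<rightarrow> G \<otimes>\<^sub>R F\<close>.
\<close>

definition corresponds ::
  "('r::comm_ring_1 \<Rightarrow> 'k::field) \<Rightarrow> ('f \<Rightarrow> 'k) \<Rightarrow>
   ('r, 'g::ab_group_add, 'y) complex_data_scheme \<Rightarrow> ('r, 'f::ring_1, 'z) complex_data_scheme \<Rightarrow>
   (('g \<times> 'f \<Rightarrow>\<^sub>0 'r) set \<Rightarrow> 'f) \<Rightarrow> (('g \<times> 'k \<Rightarrow>\<^sub>0 'r) set \<Rightarrow> 'k) \<Rightarrow> bool" where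
  "corresponds eps aug G F \<psi> \<alpha> \<longleftrightarrow>
     \<alpha> \<in> tor_dual eps G \<and> (\<forall>g. \<alpha> (tor_bar eps G g) = aug (\<psi> (GF_tensor G F g 1)))"

text \<open>The Lie action of \<open>\<pi>(R)\<close> induced in homology and transported to the dual of \<open>Tor\<close>:
  \<open>\<xi>\<close> of degree \<open>d\<close> sends \<open>\<alpha>\<close> to \<open>\<beta>\<close>.\<close>

definition lie_acts ::
  "('r::comm_ring_1 \<Rightarrow> 'k::field) \<Rightarrow> ('f \<Rightarrow> 'k) \<Rightarrow>
   ('r, 'g::ab_group_add, 'y) complex_data_scheme \<Rightarrow> ('r, 'f::ring_1, 'v, 'z) gamma_data_scheme \<Rightarrow>
   int \<Rightarrow> ('f \<Rightarrow> 'f) set \<Rightarrow> (('g \<times> 'k \<Rightarrow>\<^sub>0 'r) set \<Rightarrow> 'k) \<Rightarrow> (('g \<times> 'k \<Rightarrow>\<^sub>0 'r) set \<Rightarrow> 'k) \<Rightarrow> bool" where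
  "lie_acts eps aug G F d \<xi> \<alpha> \<beta> \<longleftrightarrow>
     (\<exists>\<theta> m \<psi> \<chi>. \<theta> \<in> \<xi> \<and> \<psi> \<in> homF_cycles G F m \<and> is_der_action G F d \<theta> m \<psi> \<chi> \<and>
        corresponds eps aug G F \<psi> \<alpha> \<and> corresponds eps aug G F \<chi> \<beta>)"

section \<open>Module structures on the dual of Tor\<close>

text \<open>Graded left (respectively right) module structures on the dual of \<open>Tor\<close> over a graded
  \<open>k\<close>-subalgebra \<open>A\<close> of \<open>Ext\<^sub>R(k,k)\<close>.\<close>

definition left_action ::
  "('r::comm_ring_1 \<Rightarrow> 'k::field) \<Rightarrow>
   ('r, 'g::ab_group_add, 'y) complex_data_scheme \<Rightarrow> ('r, 'f::ring_1, 'z) complex_data_scheme \<Rightarrow>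
   ('f \<Rightarrow> 'f) set set \<Rightarrow>
   (('f \<Rightarrow> 'f) set \<Rightarrow> (('g \<times> 'k \<Rightarrow>\<^sub>0 'r) set \<Rightarrow> 'k) \<Rightarrow> (('g \<times> 'k \<Rightarrow>\<^sub>0 'r) set \<Rightarrow> 'k)) \<Rightarrow> bool" where
  "left_action eps G F A act \<longleftrightarrow>
     (\<forall>X\<in>A. \<forall>\<alpha>\<in>tor_dual eps G. act X \<alpha> \<in> tor_dual eps G) \<and>
     (\<forall>d m. \<forall>X\<in>A \<inter> ext_deg F d. \<forall>\<alpha>\<in>tor_dual_deg eps G m. act X \<alpha> \<in> tor_dual_deg eps G (d + m)) \<and>
     (\<forall>X\<in>A. \<forall>\<alpha>\<in>tor_dual eps G. \<forall>\<beta>\<in>tor_dual eps G. act X (\<alpha> + \<beta>) = act X \<alpha> + act X \<beta>) \<and>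
     (\<forall>X\<in>A. \<forall>Y\<in>A. \<forall>\<alpha>\<in>tor_dual eps G. act (X + Y) \<alpha> = act X \<alpha> + act Y \<alpha>) \<and>
     (\<forall>X\<in>A. \<forall>Y\<in>A. \<forall>\<alpha>\<in>tor_dual eps G. act (ext_mult F X Y) \<alpha> = act X (act Y \<alpha>)) \<and>
     (\<forall>a. \<forall>\<alpha>\<in>tor_dual eps G. act (ext_scalar F a) \<alpha> = (\<lambda>t. eps a * \<alpha> t))"

definition right_action ::
  "('r::comm_ring_1 \<Rightarrow> 'k::field) \<Rightarrow>
   ('r, 'g::ab_group_add, 'y) complex_data_scheme \<Rightarrow> ('r, 'f::ring_1, 'z) complex_data_scheme \<Rightarrow>
   ('f \<Rightarrow> 'f) set set \<Rightarrow>
   ((('g \<times> 'k \<Rightarrow>\<^sub>0 'r) set \<Rightarrow> 'k) \<Rightarrow> ('f \<Rightarrow> 'f) set \<Rightarrow> (('g \<times> 'k \<Rightarrow>\<^sub>0 'r) set \<Rightarrow> 'k)) \<Rightarrow> bool" where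
  "right_action eps G F A ract \<longleftrightarrow>
     (\<forall>X\<in>A. \<forall>\<alpha>\<in>tor_dual eps G. ract \<alpha> X \<in> tor_dual eps G) \<and>
     (\<forall>d m. \<forall>X\<in>A \<inter> ext_deg F d. \<forall>\<alpha>\<in>tor_dual_deg eps G m. ract \<alpha> X \<in> tor_dual_deg eps G (m + d)) \<and>
     (\<forall>X\<in>A. \<forall>\<alpha>\<in>tor_dual eps G. \<forall>\<beta>\<in>tor_dual eps G. ract (\<alpha> + \<beta>) X = ract \<alpha> X + ract \<beta> X) \<and>
     (\<forall>X\<in>A. \<forall>Y\<in>A. \<forall>\<alpha>\<in>tor_dual eps G. ract \<alpha> (X + Y) = ract \<alpha> X + ract \<alpha> Y) \<and>
     (\<forall>X\<in>A. \<forall>Y\<in>A. \<forall>\<alpha>\<in>tor_dual eps G. ract \<alpha> (ext_mult F X Y) = ract (ract \<alpha> X) Y) \<and>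
     (\<forall>a. \<forall>\<alpha>\<in>tor_dual eps G. ract \<alpha> (ext_scalar F a) = (\<lambda>t. eps a * \<alpha> t))"

text \<open>
  The extension of the Lie action of \<open>\<pi>(R)\<close> to \<open>Ext\<^sub>R(k,k)\<close>.  A left module over the universal
  enveloping algebra is the same as a left Lie module, and \<open>U\<pi>(R) \<cong> Ext\<^sub>R(k,k)\<close> is induced by the
  inclusion \<open>Der\<^sup>\<gamma>\<^sub>R(F) \<subseteq> End\<^sub>R(F)\<close>; so the extension is the left \<open>Ext\<^sub>R(k,k)\<close>-module structure in which
  the image \<open>\<xi> + end_boundaries F\<close> of \<open>\<xi>\<close> acts as \<open>\<xi>\<close> does.
\<close>

definition extended_lie_action ::
  "('r::comm_ring_1 \<Rightarrow> 'k::field) \<Rightarrow> ('f \<Rightarrow> 'k) \<Rightarrow>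
   ('r, 'g::ab_group_add, 'y) complex_data_scheme \<Rightarrow> ('r, 'f::ring_1, 'v, 'z) gamma_data_scheme \<Rightarrow>
   (('f \<Rightarrow> 'f) set \<Rightarrow> (('g \<times> 'k \<Rightarrow>\<^sub>0 'r) set \<Rightarrow> 'k) \<Rightarrow> (('g \<times> 'k \<Rightarrow>\<^sub>0 'r) set \<Rightarrow> 'k)) \<Rightarrow> bool" where
  "extended_lie_action eps aug G F act \<longleftrightarrow>
     left_action eps G F (ext_alg F) act \<and>
     (\<forall>d. \<forall>\<xi>\<in>homotopy_lie F d. \<forall>\<alpha> \<beta>.
        lie_acts eps aug G F d \<xi> \<alpha> \<beta> \<longrightarrow> act (\<xi> + end_boundaries F) \<alpha> = \<beta>)"

section \<open>The Herzog--Iyengar action\<close>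

text \<open>The classes \<open>y i\<close>, for \<open>i\<close> in \<open>{1..e}\<close>, generate \<open>R\<^sup>!\<close>, so the two definitions below
  determine the right and the left structure uniquely.\<close>

definition herzog_iyengar_right ::
  "('r::comm_ring_1 \<Rightarrow> 'k::field) \<Rightarrow>
   ('r, 'g::ab_group_add, 'y) complex_data_scheme \<Rightarrow> ('r, 'f::ring_1, 'z) complex_data_scheme \<Rightarrow>
   nat \<Rightarrow> (nat \<Rightarrow> 'r) \<Rightarrow> (nat \<Rightarrow> ('f \<Rightarrow> 'f) set) \<Rightarrow>
   ((('g \<times> 'k \<Rightarrow>\<^sub>0 'r) set \<Rightarrow> 'k) \<Rightarrow> ('f \<Rightarrow> 'f) set \<Rightarrow> (('g \<times> 'k \<Rightarrow>\<^sub>0 'r) set \<Rightarrow> 'k)) \<Rightarrow> bool" where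
  "herzog_iyengar_right eps G F e r y ract \<longleftrightarrow>
     right_action eps G F (ext_shriek F) ract \<and>
     (\<forall>i\<in>{1..e}. \<forall>n z f. \<forall>\<alpha>\<in>tor_dual_deg eps G (1 - n).
        z \<in> gr G n \<and> (\<forall>j\<in>{1..e}. f j \<in> gr G (n - 1)) \<and> bd G z = (\<Sum>j=1..e. scal G (r j) (f j)) \<longrightarrow>
        ract \<alpha> (y i) (tor_bar eps G z) = - \<alpha> (tor_bar eps G (f i)))"

definition herzog_iyengar_left ::
  "('r::comm_ring_1 \<Rightarrow> 'k::field) \<Rightarrow>
   ('r, 'g::ab_group_add, 'y) complex_data_scheme \<Rightarrow> ('r, 'f::ring_1, 'z) complex_data_scheme \<Rightarrow>
   nat \<Rightarrow> (nat \<Rightarrow> ('f \<Rightarrow> 'f) set) \<Rightarrow>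
   ((('g \<times> 'k \<Rightarrow>\<^sub>0 'r) set \<Rightarrow> 'k) \<Rightarrow> ('f \<Rightarrow> 'f) set \<Rightarrow> (('g \<times> 'k \<Rightarrow>\<^sub>0 'r) set \<Rightarrow> 'k)) \<Rightarrow>
   (('f \<Rightarrow> 'f) set \<Rightarrow> (('g \<times> 'k \<Rightarrow>\<^sub>0 'r) set \<Rightarrow> 'k) \<Rightarrow> (('g \<times> 'k \<Rightarrow>\<^sub>0 'r) set \<Rightarrow> 'k)) \<Rightarrow> bool" where
  "herzog_iyengar_left eps G F e y ract lact \<longleftrightarrow>
     left_action eps G F (ext_shriek F) lact \<and>
     (\<forall>i\<in>{1..e}. \<forall>m. \<forall>\<alpha>\<in>tor_dual_deg eps G m. lact (y i) \<alpha> = - ksign m (ract \<alpha> (y i)))"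

end

(*
  A functional on Tor of degree m, composed with G -> G (x) k, is a cocycle on the minimal complex G,
  so it lifts to a chain map psi: G -> F of degree m, which extends F-linearly to G (x) F.  By the
  Leibniz rule theta . psi is then the F-linear extension of theta o psi.  For theta = theta_i and z of
  degree 1 - m write psi(z) = sum c_j x_j; comparing d psi(z) = sum c_j r_j with (-1)^m psi(dz), where
  dz = sum r_j f_j, minimality of the generators gives c_i = (-1)^m psi(f_i) modulo the maximal ideal,
  which is the Herzog-Iyengar value.  Finally the classes of the theta_i span Ext^1: a cycle of degree
  -1 in End(F) that vanishes on the variables of degree one is null-homotopic.
*)
theory Submission
  imports Defs
begin

section \<open>Lifting in graded free complexes\<close>

text \<open>The action of Ext enters only through the relation \<open>lie_acts\<close>:
  \<open>ext_act\<close> is pinned down at pairs \<alpha>, \<beta> for which representatives \<psi>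
  and \<theta>\<cdot>\<psi> are exhibited. The comparison therefore starts from the Herzog-Iyengar
  value \<beta> and builds the representatives that connect it to \<alpha>. That settles homogeneous
  \<alpha> and the classes of the \<open>\<theta> i\<close>; additivity in \<alpha> and the module
  laws carry the equality to all of \<open>tor_dual\<close> and \<open>ext_shriek\<close>.

  The obstacle in both lifting arguments (chain map and null homotopy) is degree 0 of
  \<open>F\<close>, where the homology is k and not 0. There the first step needs a reason of its
  own: the differential of \<open>G\<close> has coefficients in \<open>mm\<close>, which every
  functional kills; respectively, the cycle vanishes on the variables that span degree 1. In
  positive degrees exactness is extracted from Tate's process: a cycle of degree n involves only
  variables of degree at most n, so it is among the cycles killed by the variables of degree n +
  1.\<close>

definition linear_on ::
  "('r \<Rightarrow> 'a::ab_group_add \<Rightarrow> 'a) \<Rightarrow> ('r \<Rightarrow> 'b::ab_group_add \<Rightarrow> 'b) \<Rightarrow> 'a set \<Rightarrow> ('a \<Rightarrow> 'b) \<Rightarrow> bool" where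
  "linear_on sa sb U h \<longleftrightarrow>
     (\<forall>u\<in>U. \<forall>v\<in>U. h (u + v) = h u + h v) \<and> (\<forall>c. \<forall>u\<in>U. h (sa c u) = sb c (h u))"

lemma linear_on_zero: "linear_on sa sb U h \<Longrightarrow> 0 \<in> U \<Longrightarrow> h 0 = 0"
  unfolding linear_on_def by (metis add_cancel_right_right)

lemma linear_on_sum:
  assumes "linear_on sa sb U h" "module sa" "module.subspace sa U" "\<And>i. i \<in> I \<Longrightarrow> f i \<in> U"
  shows "h (\<Sum>i\<in>I. f i) = (\<Sum>i\<in>I. h (f i))"
  using assms(4)
proof (induction I rule: infinite_finite_induct)
  case (insert i I)
  have "(\<Sum>i\<in>I. f i) \<in> U"
    using insert.prems by (intro module.subspace_sum[OF assms(2,3)]) auto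
  then show ?case using assms(1) insert by (simp add: linear_on_def)
qed (use linear_on_zero[OF assms(1)] module.subspace_0[OF assms(2,3)] in auto)

lemma [simp]:
  "ksign n 0 = 0" "ksign n (a + b) = ksign n a + ksign n b" "ksign n (a - b) = ksign n a - ksign n b"
  "ksign n (- a) = - ksign n a" "ksign n (ksign n a) = a"
  by (simp_all add: ksign_def)

lemma ksign_mem: "module s \<Longrightarrow> module.subspace s U \<Longrightarrow> a \<in> U \<Longrightarrow> ksign n a \<in> U"
  by (simp add: ksign_def module.subspace_neg)

lemma module_hom_ksign: "module_hom s1 s2 h \<Longrightarrow> h (ksign n a) = ksign n (h a)"
  by (simp add: ksign_def module_hom.neg)

lemma module_scale_ksign: "module s \<Longrightarrow> s c (ksign n a) = ksign n (s c a)"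
  by (simp add: ksign_def module.scale_minus_right)

section \<open>Homogeneous components in a graded complex\<close>

definition homog_part ::
  "('r, 'a::ab_group_add, 'z) complex_data_scheme \<Rightarrow> int \<Rightarrow> 'a \<Rightarrow> 'a" where
  "homog_part C n a =
     (THE c. (\<forall>n. c n \<in> gr C n) \<and> finite {n. c n \<noteq> 0} \<and> a = (\<Sum>n | c n \<noteq> 0. c n)) n"

locale graded_complex =
  fixes C :: "('r::comm_ring_1, 'a::ab_group_add, 'z) complex_data_scheme"
  assumes nonneg_complex: "nonneg_complex C"
begin

lemma module_scal: "module (scal C)"
  and subspace_gr: "module.subspace (scal C) (gr C n)"
  and gr_neg: "n < 0 \<Longrightarrow> gr C n = {0}"
  and ex1_homog: "\<exists>!c. (\<forall>n. c n \<in> gr C n) \<and> finite {n. c n \<noteq> 0} \<and> a = (\<Sum>n | c n \<noteq> 0. c n)"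
  and module_hom_bd: "module_hom (scal C) (scal C) (bd C)"
  and bd_gr: "z \<in> gr C n \<Longrightarrow> bd C z \<in> gr C (n - 1)"
  and bd_bd: "bd C (bd C a) = 0"
proof -
  note * = nonneg_complex[unfolded nonneg_complex_def]
  show "module (scal C)" "module.subspace (scal C) (gr C n)" "n < 0 \<Longrightarrow> gr C n = {0}"
    "module_hom (scal C) (scal C) (bd C)" "bd C (bd C a) = 0"
    using * by (elim conjE, simp)+
  show "\<exists>!c. (\<forall>n. c n \<in> gr C n) \<and> finite {n. c n \<noteq> 0} \<and> a = (\<Sum>n | c n \<noteq> 0. c n)"
    using * by (elim conjE) (erule spec)
  have "\<forall>n. bd C ` gr C n \<subseteq> gr C (n - 1)"
    using * by (elim conjE)
  then show "z \<in> gr C n \<Longrightarrow> bd C z \<in> gr C (n - 1)"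
    by blast
qed

sublocale module "scal C"
  by (rule module_scal)

sublocale bd: module_hom "scal C" "scal C" "bd C"
  by (rule module_hom_bd)

lemma gr_0: "0 \<in> gr C n"
  by (rule subspace_0[OF subspace_gr])

lemma homog_part_props:
  "homog_part C n a \<in> gr C n" "finite {n. homog_part C n a \<noteq> 0}"
  "(\<Sum>n | homog_part C n a \<noteq> 0. homog_part C n a) = a"
proof -
  define c where
    "c = (THE c. (\<forall>n. c n \<in> gr C n) \<and> finite {n. c n \<noteq> 0} \<and> a = (\<Sum>n | c n \<noteq> 0. c n))"
  have eq: "homog_part C n a = c n" for n
    by (simp add: homog_part_def c_def)
  have c: "(\<forall>n. c n \<in> gr C n) \<and> finite {n. c n \<noteq> 0} \<and> a = (\<Sum>n | c n \<noteq> 0. c n)"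
    unfolding c_def by (rule theI'[OF ex1_homog])
  show "homog_part C n a \<in> gr C n" "finite {n. homog_part C n a \<noteq> 0}"
    "(\<Sum>n | homog_part C n a \<noteq> 0. homog_part C n a) = a"
    unfolding eq by (use c in metis)+
qed

lemma sum_homog_part:
  assumes "finite S" "{n. homog_part C n a \<noteq> 0} \<subseteq> S"
  shows "(\<Sum>n\<in>S. homog_part C n a) = a"
proof -
  have "(\<Sum>n | homog_part C n a \<noteq> 0. homog_part C n a) = (\<Sum>n\<in>S. homog_part C n a)"
    using assms by (intro sum.mono_neutral_left) auto
  then show ?thesis by (simp only: homog_part_props(3))
qed

lemma homog_part_eqI:
  assumes "\<And>n. c n \<in> gr C n" "finite S" "{n. c n \<noteq> 0} \<subseteq> S" "a = (\<Sum>n\<in>S. c n)"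
  shows "homog_part C n a = c n"
proof -
  have "a = (\<Sum>n | c n \<noteq> 0. c n)"
    unfolding assms(4) using assms(2,3) by (intro sum.mono_neutral_right) auto
  moreover have "finite {n. c n \<noteq> 0}"
    using assms(2,3) by (rule rev_finite_subset)
  ultimately have "(THE c. (\<forall>n. c n \<in> gr C n) \<and> finite {n. c n \<noteq> 0} \<and> a = (\<Sum>n | c n \<noteq> 0. c n)) = c"
    using assms(1) by (intro the1_equality[OF ex1_homog] conjI allI)
  then show ?thesis by (simp add: homog_part_def)
qed

lemma homog_part_homog: "z \<in> gr C m \<Longrightarrow> homog_part C n z = (if n = m then z else 0)"
  by (rule homog_part_eqI[where c = "\<lambda>n. if n = m then z else 0" and S = "{m}"]) (auto simp: gr_0)

lemma homog_part_add: "homog_part C n (a + b) = homog_part C n a + homog_part C n b"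
proof -
  let ?S = "{n. homog_part C n a \<noteq> 0} \<union> {n. homog_part C n b \<noteq> 0}"
  have "finite ?S" using homog_part_props(2) by auto
  moreover from this have "a + b = (\<Sum>n\<in>?S. homog_part C n a + homog_part C n b)"
    by (simp add: sum.distrib sum_homog_part)
  ultimately show ?thesis
    by (intro homog_part_eqI[where c = "\<lambda>n. homog_part C n a + homog_part C n b" and S = ?S]
        subspace_add subspace_gr homog_part_props(1)) auto
qed

lemma homog_part_scale: "homog_part C n (scal C c a) = scal C c (homog_part C n a)"
proof (rule homog_part_eqI[where c = "\<lambda>n. scal C c (homog_part C n a)"
      and S = "{n. homog_part C n a \<noteq> 0}"])
  show "scal C c a = (\<Sum>n | homog_part C n a \<noteq> 0. scal C c (homog_part C n a))"
    by (simp add: scale_sum_right[symmetric] homog_part_props)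
qed (auto intro: subspace_scale subspace_gr homog_part_props(1,2))

lemma module_hom_homog_part: "module_hom (scal C) (scal C) (homog_part C n)"
  by (intro module_hom.intro module_scal module_hom_axioms.intro homog_part_add homog_part_scale)

lemma homog_induct [case_names zero homog add]:
  assumes "P 0" "\<And>n z. z \<in> gr C n \<Longrightarrow> P z" "\<And>a b. P a \<Longrightarrow> P b \<Longrightarrow> P (a + b)"
  shows "P a"
proof -
  have "P (\<Sum>n\<in>S. homog_part C n a)" for S
    by (induction S rule: infinite_finite_induct) (auto intro: assms homog_part_props)
  from this[of "{n. homog_part C n a \<noteq> 0}"] show ?thesis by (simp add: homog_part_props)
qed

text \<open>An element has finitely many nonzero components, so the values of the \<open>k n\<close>
  on them can be summed. Since \<open>k n 0 = 0\<close>, the support may be replaced by any larger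
  finite set; this is how the values at \<open>a\<close>, \<open>b\<close> and \<open>a + b\<close>
  are compared.\<close>

lemma glue_degreewise:
  assumes sb: "module sb" and k: "\<And>n. linear_on (scal C) sb (gr C n) (k n)"
  shows "\<exists>h. module_hom (scal C) sb h \<and> (\<forall>n. \<forall>z\<in>gr C n. h z = k n z)"
proof -
  have k0: "k n 0 = 0" for n
    using linear_on_zero[OF k gr_0] .
  define h where "h a = (\<Sum>n | homog_part C n a \<noteq> 0. k n (homog_part C n a))" for a
  have h_eq: "h a = (\<Sum>n\<in>S. k n (homog_part C n a))"
    if "finite S" "{n. homog_part C n a \<noteq> 0} \<subseteq> S" for a S
    unfolding h_def using that by (intro sum.mono_neutral_left) (auto simp: k0)
  interpret sb: module sb by (rule sb)
  have "module_hom (scal C) sb h"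
  proof
    fix a b
    let ?S = "{n. homog_part C n a \<noteq> 0} \<union> {n. homog_part C n b \<noteq> 0}"
    have fin: "finite ?S" using homog_part_props(2) by auto
    have "{n. homog_part C n (a + b) \<noteq> 0} \<subseteq> ?S"
      by (auto simp: homog_part_add)
    from h_eq[OF fin this] h_eq[OF fin Un_upper1] h_eq[OF fin Un_upper2]
    have "h (a + b) = (\<Sum>n\<in>?S. k n (homog_part C n (a + b)))"
      "h a = (\<Sum>n\<in>?S. k n (homog_part C n a))" "h b = (\<Sum>n\<in>?S. k n (homog_part C n b))"
      by blast+
    moreover have "k n (homog_part C n a + homog_part C n b) =
        k n (homog_part C n a) + k n (homog_part C n b)" for n
      using k homog_part_props(1) by (auto simp: linear_on_def)
    ultimately show "h (a + b) = h a + h b"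
      by (simp only: homog_part_add sum.distrib)
  next
    fix c a
    let ?S = "{n. homog_part C n a \<noteq> 0}"
    have "{n. homog_part C n (scal C c a) \<noteq> 0} \<subseteq> ?S"
      by (auto simp: homog_part_scale)
    from h_eq[OF homog_part_props(2) this]
    have "h (scal C c a) = (\<Sum>n\<in>?S. k n (homog_part C n (scal C c a)))" .
    moreover have "k n (scal C c (homog_part C n a)) = sb c (k n (homog_part C n a))" for n
      using k homog_part_props(1) by (auto simp: linear_on_def)
    ultimately show "h (scal C c a) = sb c (h a)"
      by (simp only: homog_part_scale sb.scale_sum_right h_def)
  qed
  moreover have "h z = k n z" if z: "z \<in> gr C n" for n z
  proof -
    have "{m. homog_part C m z \<noteq> 0} \<subseteq> {n}"
      using z by (auto simp: homog_part_homog split: if_splits)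
    from h_eq[OF _ this] show ?thesis using z by (simp add: homog_part_homog)
  qed
  ultimately show ?thesis by (intro exI[of _ h]) simp
qed

lemma module_hom_eqI:
  assumes "module_hom (scal C) sb f" "module_hom (scal C) sb g"
    "\<And>n z. z \<in> gr C n \<Longrightarrow> f z = g z"
  shows "f = g"
proof
  fix a
  show "f a = g a"
    by (induction a rule: homog_induct)
       (simp_all add: assms(3) module_hom.zero[OF assms(1)] module_hom.zero[OF assms(2)]
         module_hom.add[OF assms(1)] module_hom.add[OF assms(2)])
qed

end

text \<open>Free modules are projective: choose preimages on a basis and extend by coordinates.
  Linearity is demanded on \<open>U\<close> only, because the components of a complex are subsets of
  one total type; \<open>V\<close> keeps the lift inside the intended component of the
  target.\<close>

lemma free_lift:
  fixes D :: "'b::ab_group_add \<Rightarrow> 'c::ab_group_add"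
  assumes free: "free_submodule sa U" and sa: "module sa" and D: "module_hom sb sc D"
    and V: "module.subspace sb V" and w: "linear_on sa sc U w" and wV: "w ` U \<subseteq> D ` V"
  shows "\<exists>h. linear_on sa sb U h \<and> h ` U \<subseteq> V \<and> (\<forall>u\<in>U. D (h u) = w u)"
proof -
  interpret sa: module sa by (rule sa)
  interpret D: module_hom sb sc D by (rule D)
  obtain B where B: "\<not> sa.dependent B" "sa.span B = U"
    using free by (auto simp: free_submodule_def)
  have "\<forall>b\<in>B. \<exists>v\<in>V. D v = w b"
    using wV sa.span_base B(2) by fastforce
  then obtain t where t: "\<And>b. b \<in> B \<Longrightarrow> t b \<in> V" "\<And>b. b \<in> B \<Longrightarrow> D (t b) = w b"
    by metis
  let ?rep = "sa.representation B"
  define h where "h u = (\<Sum>b | ?rep u b \<noteq> 0. sb (?rep u b) (t b))" for u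
  have fin: "finite {b. ?rep u b \<noteq> 0}" and sub: "?rep u b \<noteq> 0 \<Longrightarrow> b \<in> B"
    and rep: "u \<in> U \<Longrightarrow> (\<Sum>b | ?rep u b \<noteq> 0. sa (?rep u b) b) = u" for u b
    using sa.finite_representation sa.representation_ne_zero sa.sum_nonzero_representation_eq B by auto
  have h_eq: "h u = (\<Sum>b\<in>S. sb (?rep u b) (t b))" if "finite S" "{b. ?rep u b \<noteq> 0} \<subseteq> S" for u S
    unfolding h_def using that by (intro sum.mono_neutral_left) auto
  have "h (u + v) = h u + h v" if "u \<in> U" "v \<in> U" for u v
  proof -
    let ?S = "{b. ?rep u b \<noteq> 0} \<union> {b. ?rep v b \<noteq> 0}"
    have add: "?rep (u + v) b = ?rep u b + ?rep v b" for b
      using that B by (simp add: sa.representation_add)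
    have fin: "finite ?S" using fin by simp
    have "{b. ?rep (u + v) b \<noteq> 0} \<subseteq> ?S"
      by (auto simp: add)
    from h_eq[OF fin this] h_eq[OF fin Un_upper1] h_eq[OF fin Un_upper2]
    show ?thesis
      by (simp only: add D.m1.scale_left_distrib sum.distrib)
  qed
  moreover have "h (sa c u) = sb c (h u)" if "u \<in> U" for c u
  proof -
    let ?S = "{b. ?rep u b \<noteq> 0}"
    have scl: "?rep (sa c u) b = c * ?rep u b" for b
      using that B by (simp add: sa.representation_scale)
    have "{b. ?rep (sa c u) b \<noteq> 0} \<subseteq> ?S"
      by (auto simp: scl)
    from h_eq[OF fin this] show ?thesis
      by (simp add: scl D.m1.scale_sum_right h_def)
  qed
  moreover have "h u \<in> V" for u
    unfolding h_def using t sub by (intro D.m1.subspace_sum[OF V] D.m1.subspace_scale[OF V]) auto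
  moreover have "D (h u) = w u" if u: "u \<in> U" for u
  proof -
    have subspU: "sa.subspace U" using B(2) sa.subspace_span by metis
    have "D (h u) = (\<Sum>b | ?rep u b \<noteq> 0. sc (?rep u b) (w b))"
      unfolding h_def D.sum using t sub by (intro sum.cong) (auto simp: D.scale)
    also have "\<dots> = (\<Sum>b | ?rep u b \<noteq> 0. w (sa (?rep u b) b))"
      using w sub B(2) by (intro sum.cong) (auto simp: linear_on_def sa.span_base)
    also have "\<dots> = w (\<Sum>b | ?rep u b \<noteq> 0. sa (?rep u b) b)"
      using sub B(2) by (intro linear_on_sum[OF w sa subspU, symmetric])
        (auto intro: sa.span_base sa.span_scale)
    finally show ?thesis using rep[OF u] by simp
  qed
  ultimately show ?thesis
    by (intro exI[of _ h]) (auto simp: linear_on_def)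
qed

text \<open>Solves \<partial>h = u + (-1)^k h\<partial> degree by degree. By \<open>u_cycle\<close>
  the right side is a cycle, hence a boundary where \<open>F\<close> is exact; at the bottom, the
  map \<open>h0\<close> into degree 0 and the first boundary condition \<open>h1\<close> are given
  as data. With \<open>u = 0\<close> the solution is a chain map up to sign; with \<open>u\<close> a
  cycle of degree -1 and \<open>d = k = 0\<close> it is a null homotopy.\<close>

lemma chain_lift:
  fixes C :: "('r::comm_ring_1, 'a::ab_group_add, 'y) complex_data_scheme"
    and F :: "('r, 'b::ab_group_add, 'z) complex_data_scheme"
  assumes C: "graded_complex C" and F: "graded_complex F"
    and free: "\<And>n. free_submodule (scal C) (gr C n)"
    and acyclic: "\<And>n z. n > 0 \<Longrightarrow> z \<in> gr F n \<Longrightarrow> bd F z = 0 \<Longrightarrow> z \<in> bd F ` gr F (n + 1)"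
    and u: "module_hom (scal C) (scal F) u" "\<And>n z. z \<in> gr C n \<Longrightarrow> u z \<in> gr F (n + d - 1)"
    and u_cycle: "\<And>z. bd F (u z) + ksign k (u (bd C z)) = 0"
    and h0: "linear_on (scal C) (scal F) (gr C (- d)) h0" "h0 ` gr C (- d) \<subseteq> gr F 0"
    and h1: "\<And>z. z \<in> gr C (1 - d) \<Longrightarrow> u z + ksign k (h0 (bd C z)) \<in> bd F ` gr F 1"
  shows "\<exists>h. module_hom (scal C) (scal F) h \<and> (\<forall>n. h ` gr C n \<subseteq> gr F (n + d)) \<and>
     (\<forall>z. bd F (h z) = u z + ksign k (h (bd C z))) \<and> (\<forall>z\<in>gr C (- d). h z = h0 z)"
proof -
  interpret C: graded_complex C by (rule C)
  interpret F: graded_complex F by (rule F)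
  interpret u: module_hom "scal C" "scal F" u by (rule u)
  \<comment> \<open>Stages are numbered by the degree \<open>j\<close> of the target, so stage 0
    lives on degree \<open>- d\<close> of \<open>C\<close>.\<close>
  let ?c = "\<lambda>j::nat. int j - d"
  \<comment> \<open>The third clause anticipates the next stage: it is exactly the hypothesis under
    which \<open>free_lift\<close> can continue. The last clause ties the recursion to
    \<open>h0\<close>.\<close>
  define P where "P j h \<longleftrightarrow> linear_on (scal C) (scal F) (gr C (?c j)) h \<and> h ` gr C (?c j) \<subseteq> gr F (int j) \<and>
     (\<forall>z\<in>gr C (?c (Suc j)). u z + ksign k (h (bd C z)) \<in> bd F ` gr F (int (Suc j))) \<and>
     (j = 0 \<longrightarrow> h = h0)" for j h
  define Q where "Q j h h' \<longleftrightarrow> (\<forall>z\<in>gr C (?c (Suc j)). bd F (h' z) = u z + ksign k (h (bd C z)))"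
    for j :: nat and h h'
  have "\<exists>hs. \<forall>j. P j (hs j) \<and> Q j (hs j) (hs (Suc j))"
  proof (rule dependent_nat_choice)
    show "\<exists>h. P 0 h"
      using h0 h1 by (intro exI[of _ h0]) (auto simp: P_def)
  next
    fix h j assume P: "P j h"
    let ?w = "\<lambda>z. u z + ksign k (h (bd C z))"
    have cj: "?c (Suc j) - 1 = ?c j" by simp
    have bdC: "bd C z \<in> gr C (?c j)" if "z \<in> gr C (?c (Suc j))" for z
      using C.bd_gr[OF that] unfolding cj .
    have "linear_on (scal C) (scal F) (gr C (?c (Suc j))) ?w"
      using P bdC by (auto simp: P_def linear_on_def u.add u.scale C.bd.add C.bd.scale
        module_scale_ksign[OF F.module_scal] F.scale_right_distrib)
    moreover have "?w ` gr C (?c (Suc j)) \<subseteq> bd F ` gr F (int (Suc j))"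
      using P by (auto simp: P_def)
    ultimately obtain h' where h': "linear_on (scal C) (scal F) (gr C (?c (Suc j))) h'"
        "h' ` gr C (?c (Suc j)) \<subseteq> gr F (int (Suc j))" "\<forall>z\<in>gr C (?c (Suc j)). bd F (h' z) = ?w z"
      using free_lift[OF free C.module_scal F.module_hom_bd F.subspace_gr] by blast
    have "u z + ksign k (h' (bd C z)) \<in> bd F ` gr F (int (Suc (Suc j)))"
      if z: "z \<in> gr C (?c (Suc (Suc j)))" for z
    proof -
      have bz: "bd C z \<in> gr C (?c (Suc j))"
        using C.bd_gr[OF z] by (simp add: algebra_simps)
      have "u z \<in> gr F (int (Suc j))"
        using u(2)[OF z] by (simp add: algebra_simps)
      moreover have "h' (bd C z) \<in> gr F (int (Suc j))"
        using h'(2) bz by auto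
      moreover have "bd F (u z + ksign k (h' (bd C z))) = 0"
      proof -
        \<comment> \<open>The contribution of the earlier stage disappears because
          \<partial>\<partial> = 0; what remains is \<open>u_cycle\<close>.\<close>
        have "h (bd C (bd C z)) = 0"
          using linear_on_zero[of "scal C" "scal F" "gr C (?c j)" h] P C.gr_0
          by (auto simp: P_def C.bd_bd)
        then show ?thesis
          using h'(3) bz u_cycle[of z]
          by (simp add: F.bd.add module_hom_ksign[OF F.module_hom_bd] algebra_simps)
      qed
      ultimately show ?thesis
        using acyclic[of "int (Suc j)" "u z + ksign k (h' (bd C z))"]
          F.subspace_add[OF F.subspace_gr] ksign_mem[OF F.module_scal F.subspace_gr]
        by (simp add: algebra_simps)
    qed
    then have "P (Suc j) h'" using h' by (auto simp: P_def)
    moreover have "Q j h h'" using h'(3) by (simp add: Q_def)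
    ultimately show "\<exists>h'. P (Suc j) h' \<and> Q j h h'" by blast
  qed
  then obtain hs where hs: "\<And>j. P j (hs j)" "\<And>j. Q j (hs j) (hs (Suc j))" by blast
  have hs0: "hs 0 = h0" using hs(1)[of 0] by (simp add: P_def)
  \<comment> \<open>For negative target degree \<open>nat\<close> would fall back to stage 0;
    \<open>F\<close> vanishes there, so the zero map is the correct value.\<close>
  define K where "K n = (if n + d < 0 then (\<lambda>_. 0) else hs (nat (n + d)))" for n
  have "linear_on (scal C) (scal F) (gr C n) (K n)" for n
    using hs(1)[of "nat (n + d)"] by (auto simp: P_def K_def linear_on_def)
  then obtain h where h: "module_hom (scal C) (scal F) h" "\<And>n z. z \<in> gr C n \<Longrightarrow> h z = K n z"
    using C.glue_degreewise[OF F.module_scal] by blast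
  interpret h: module_hom "scal C" "scal F" h by (rule h)
  have deg: "h z \<in> gr F (n + d)" if "z \<in> gr C n" for n z
    using hs(1)[of "nat (n + d)"] that h(2)[OF that] F.gr_0 by (auto simp: K_def P_def image_subset_iff)
  have "(\<lambda>z. bd F (h z)) = (\<lambda>z. u z + ksign k (h (bd C z)))"
  proof (rule C.module_hom_eqI)
    show "module_hom (scal C) (scal F) (\<lambda>z. bd F (h z))"
      by unfold_locales (simp_all add: h.add F.bd.add h.scale F.bd.scale)
    show "module_hom (scal C) (scal F) (\<lambda>z. u z + ksign k (h (bd C z)))"
      by unfold_locales (simp_all add: h.add h.scale C.bd.add C.bd.scale u.add u.scale
        module_scale_ksign[OF F.module_scal] F.scale_right_distrib)
  next
    fix n z assume z: "z \<in> gr C n"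
    have bz: "bd C z \<in> gr C (n - 1)" by (rule C.bd_gr[OF z])
    show "bd F (h z) = u z + ksign k (h (bd C z))"
    \<comment> \<open>The recursion equation \<open>Q\<close> starts at target degree 1. Up to
      target degree 0 all three terms lie in negative degrees of \<open>F\<close> and
      vanish.\<close>
    proof (cases "n + d \<le> 0")
      case True
      have "bd F (h z) = 0"
        using F.bd_gr[OF deg[OF z]] True F.gr_neg[of "n + d - 1"] by simp
      moreover have "u z = 0"
        using u(2)[OF z] True F.gr_neg[of "n + d - 1"] by simp
      moreover have "h (bd C z) = 0"
        using deg[OF bz] True F.gr_neg[of "n - 1 + d"] by simp
      ultimately show ?thesis by simp
    next
      case False
      define j where "j = nat (n - 1 + d)"
      have n: "n = ?c (Suc j)" using False by (simp add: j_def)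
      have "nat (1 + int j) = Suc j" by simp
      then have "h z = hs (Suc j) z" "h (bd C z) = hs j (bd C z)"
        using h(2)[OF z] h(2)[OF bz] by (auto simp: K_def n)
      then show ?thesis using hs(2)[of j] z unfolding Q_def n by simp
    qed
  qed
  moreover have "h z = h0 z" if "z \<in> gr C (- d)" for z
    using h(2)[OF that] by (simp add: K_def hs0)
  ultimately show ?thesis
    using h(1) deg by (intro exI[of _ h]) (auto simp: fun_eq_iff)
qed

section \<open>Tensor products and the dual of Tor\<close>

lemma coset_eq_iff:
  assumes "module s" "module.subspace s N"
  shows "p +o N = q +o N \<longleftrightarrow> p - q \<in> N"
proof
  assume eq: "p +o N = q +o N"
  have "p + 0 \<in> p +o N"
    using module.subspace_0[OF assms] by (rule set_plus_intro2)
  then show "p - q \<in> N" unfolding eq by (simp add: set_minus_plus)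
next
  assume pq: "p - q \<in> N"
  have "p +o N = q +o ((p - q) +o N)"
    by (simp add: set_plus_rearrange2)
  moreover have "(p - q) +o N = N"
  proof (intro equalityI subsetI)
    fix x assume "x \<in> (p - q) +o N"
    then have "x - (p - q) \<in> N" by (simp add: set_minus_plus)
    from module.subspace_add[OF assms this pq] show "x \<in> N" by simp
  next
    fix x assume "x \<in> N"
    from module.subspace_diff[OF assms this pq] show "x \<in> (p - q) +o N"
      by (simp add: set_minus_plus)
  qed
  ultimately show "p +o N = q +o N" by simp
qed

lemma subspace_set_plus: "module s \<Longrightarrow> module.subspace s N \<Longrightarrow> N + N = N"
proof -
  assume a: "module s" "module.subspace s N"
  have "N + N \<subseteq> N"
    using module.subspace_add[OF a] by (auto elim!: set_plus_elim)
  moreover have "N \<subseteq> N + N"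
    by (rule set_zero_plus2[OF module.subspace_0[OF a]])
  ultimately show ?thesis by blast
qed

lemma lookup_map_times:
  "Poly_Mapping.lookup (Poly_Mapping.map ((*) r) p) k = r * Poly_Mapping.lookup p k"
  for r :: "'r::comm_ring_1"
  by (simp add: Poly_Mapping.map.rep_eq when_def)

lemma module_poly_mapping: "module (\<lambda>r::'r::comm_ring_1. Poly_Mapping.map ((*) r) :: ('a \<Rightarrow>\<^sub>0 'r) \<Rightarrow> _)"
  by unfold_locales (rule poly_mapping_eqI;
    simp add: lookup_add lookup_map_times algebra_simps)+

lemma sum_single_lookup:
  "(\<Sum>k\<in>Poly_Mapping.keys p. Poly_Mapping.single k (Poly_Mapping.lookup p k)) = p"
  by (rule poly_mapping_eqI) (simp add: lookup_sum lookup_single when_def in_keys_iff)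

context
  fixes sa :: "'r::comm_ring_1 \<Rightarrow> 'a::ab_group_add \<Rightarrow> 'a"
    and sb :: "'r \<Rightarrow> 'b::ab_group_add \<Rightarrow> 'b"
begin

interpretation pm: module "\<lambda>r::'r. Poly_Mapping.map ((*) r) :: ('a \<times> 'b \<Rightarrow>\<^sub>0 'r) \<Rightarrow> _"
  by (rule module_poly_mapping)

lemma subspace_tensor_null:
  "module.subspace (\<lambda>r. Poly_Mapping.map ((*) r)) (tensor_null sa sb)"
  unfolding tensor_null_def by (rule pm.subspace_span)

lemmas tensor_coset_eq_iff = coset_eq_iff[OF module_poly_mapping subspace_tensor_null]

lemma tensor_coset_plus:
  "(p +o tensor_null sa sb) + (q +o tensor_null sa sb) = (p + q) +o tensor_null sa sb"
  by (simp add: set_plus_rearrange subspace_set_plus[OF module_poly_mapping subspace_tensor_null])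

lemma pure_tensor_in_carrier: "pure_tensor sa sb a b \<in> tensor_carrier sa sb"
  by (simp add: pure_tensor_def tensor_carrier_def)

lemma pure_tensor_add_left:
  "pure_tensor sa sb (a + a') b = pure_tensor sa sb a b + pure_tensor sa sb a' b"
  unfolding pure_tensor_def tensor_coset_plus tensor_coset_eq_iff
  unfolding tensor_null_def diff_diff_eq[symmetric] by (rule pm.span_base) blast

lemma pure_tensor_scale_left:
  "pure_tensor sa sb (sa r a) b = Poly_Mapping.single (a, b) r +o tensor_null sa sb"
  unfolding pure_tensor_def tensor_coset_plus tensor_coset_eq_iff
  unfolding tensor_null_def by (rule pm.span_base) blast

lemma pure_tensor_scale_right: "pure_tensor sa sb a (sb r b) = pure_tensor sa sb (sa r a) b"
  unfolding pure_tensor_scale_left unfolding pure_tensor_def tensor_coset_eq_iff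
  unfolding tensor_null_def by (rule pm.span_base) blast

lemma pure_tensor_zero: "pure_tensor sa sb 0 b = 0 +o tensor_null sa sb"
  using pure_tensor_add_left[of 0 0 b]
  unfolding pure_tensor_def tensor_coset_plus tensor_coset_eq_iff
  using pm.subspace_neg[OF subspace_tensor_null] by fastforce

text \<open>A coefficient can be absorbed into the left factor, so each coset is a sum of pure
  tensors and no case for scalar multiples arises. The empty sum is the pure tensor with left factor
  0.\<close>

lemma tensor_carrier_induct [consumes 1, case_names pure add]:
  assumes "t \<in> tensor_carrier sa sb"
    and pure: "\<And>a b. P (pure_tensor sa sb a b)"
    and add: "\<And>s t. s \<in> tensor_carrier sa sb \<Longrightarrow> t \<in> tensor_carrier sa sb \<Longrightarrow> P s \<Longrightarrow> P t \<Longrightarrow> P (s + t)"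
  shows "P t"
proof -
  obtain p where t: "t = p +o tensor_null sa sb"
    using assms(1) by (auto simp: tensor_carrier_def)
  have "P ((\<Sum>k\<in>K. Poly_Mapping.single k (Poly_Mapping.lookup p k)) +o tensor_null sa sb)" for K
  proof (induction K rule: infinite_finite_induct)
    case (insert k K)
    obtain a b where k: "k = (a, b)" by fastforce
    show ?case
      using insert pure[of "sa (Poly_Mapping.lookup p k) a" b]
      by (auto simp: tensor_coset_plus[symmetric] pure_tensor_scale_left k tensor_carrier_def intro!: add)
  qed (use pure[of 0] pure_tensor_zero in auto)
  from this[of "Poly_Mapping.keys p"] show ?thesis
    by (simp add: t sum_single_lookup)
qed

text \<open>Universal property of the tensor product: the evaluation \<open>ev\<close> on the free
  module kills the defining relations and so depends only on the coset. The value 0 off the carrier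
  matches the normalisation in \<open>tor_functionals\<close>.\<close>

lemma tensor_lift:
  fixes sc :: "'r \<Rightarrow> 'c::ab_group_add \<Rightarrow> 'c"
  assumes sc: "module sc"
    and add_left: "\<And>a a' b. \<Phi> (a + a') b = \<Phi> a b + \<Phi> a' b"
    and add_right: "\<And>a b b'. \<Phi> a (b + b') = \<Phi> a b + \<Phi> a b'"
    and scale_left: "\<And>r a b. \<Phi> (sa r a) b = sc r (\<Phi> a b)"
    and scale_right: "\<And>r a b. \<Phi> a (sb r b) = sc r (\<Phi> a b)"
  shows "\<exists>L. (\<forall>s\<in>tensor_carrier sa sb. \<forall>t\<in>tensor_carrier sa sb. L (s + t) = L s + L t) \<and>
     (\<forall>a b. L (pure_tensor sa sb a b) = \<Phi> a b) \<and> (\<forall>t. t \<notin> tensor_carrier sa sb \<longrightarrow> L t = 0)"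
proof -
  interpret sc: module sc by (rule sc)
  define ev where "ev p = (\<Sum>k\<in>Poly_Mapping.keys p. sc (Poly_Mapping.lookup p k) (\<Phi> (fst k) (snd k)))" for p
  have ev_eq: "ev p = (\<Sum>k\<in>S. sc (Poly_Mapping.lookup p k) (\<Phi> (fst k) (snd k)))"
    if "finite S" "Poly_Mapping.keys p \<subseteq> S" for p S
    unfolding ev_def using that by (intro sum.mono_neutral_left) (auto simp: in_keys_iff)
  have ev_add: "ev (p + q) = ev p + ev q" for p q
  proof -
    let ?S = "Poly_Mapping.keys p \<union> Poly_Mapping.keys q"
    have fin: "finite ?S" by simp
    from ev_eq[OF fin keys_add] ev_eq[OF fin Un_upper1] ev_eq[OF fin Un_upper2]
    show ?thesis by (simp only: lookup_add sc.scale_left_distrib sum.distrib)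
  qed
  have ev_scale: "ev (Poly_Mapping.map ((*) r) p) = sc r (ev p)" for r p
  proof -
    have "Poly_Mapping.keys (Poly_Mapping.map ((*) r) p) \<subseteq> Poly_Mapping.keys p"
      by (auto simp: in_keys_iff lookup_map_times)
    from ev_eq[OF finite_keys this] show ?thesis
      unfolding ev_def sc.scale_sum_right
      by (simp add: lookup_map_times)
  qed
  have ev_single: "ev (Poly_Mapping.single (a, b) r) = sc r (\<Phi> a b)" for a b r
    by (simp add: ev_def)
  interpret ev: module_hom "\<lambda>r. Poly_Mapping.map ((*) r)" sc ev
    by unfold_locales (fact ev_add ev_scale)+
  have "tensor_null sa sb \<subseteq> {p. ev p = 0}"
    unfolding tensor_null_def
    by (rule pm.span_minimal[OF _ ev.subspace_kernel])
       (auto simp: ev.diff ev_single add_left add_right scale_left scale_right)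
  then have ev_coset: "ev p = ev q" if "p +o tensor_null sa sb = q +o tensor_null sa sb" for p q
    using that ev.diff[of p q] by (auto simp: tensor_coset_eq_iff)
  define L where "L t = (if t \<in> tensor_carrier sa sb then ev (SOME p. t = p +o tensor_null sa sb) else 0)" for t
  have L: "L (p +o tensor_null sa sb) = ev p" for p
  proof -
    let ?q = "SOME q. p +o tensor_null sa sb = q +o tensor_null sa sb"
    have "p +o tensor_null sa sb = ?q +o tensor_null sa sb" by (rule someI) (rule refl)
    then have "ev ?q = ev p" by (rule ev_coset[symmetric])
    then show ?thesis by (simp add: L_def tensor_carrier_def)
  qed
  show ?thesis
  proof (intro exI[of _ L] conjI ballI allI impI)
    fix s t assume "s \<in> tensor_carrier sa sb" "t \<in> tensor_carrier sa sb"
    then obtain p q where "s = p +o tensor_null sa sb" "t = q +o tensor_null sa sb"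
      by (auto simp: tensor_carrier_def)
    then show "L (s + t) = L s + L t" by (simp only: tensor_coset_plus L ev_add)
  next
    fix a b show "L (pure_tensor sa sb a b) = \<Phi> a b"
      by (simp add: pure_tensor_def L ev_single)
  qed (simp add: L_def)
qed

end

section \<open>The residue field and the graded dual of Tor\<close>

lemma residue_field_hom:
  assumes "residue_field mm eps"
  shows "eps 1 = 1" "eps (a + b) = eps a + eps b" "eps (a * b) = eps a * eps b" "eps 0 = 0"
    "eps (- a) = - eps a" "eps (a - b) = eps a - eps b" "eps a = 0 \<longleftrightarrow> a \<in> mm" "\<exists>a. eps a = c"
proof -
  show *: "eps 1 = 1" "eps (a + b) = eps a + eps b" "eps (a * b) = eps a * eps b" for a b
    using assms by (auto simp: residue_field_def)
  show z: "eps 0 = 0" using *(2)[of 0 0] by (simp only: add_0 add_cancel_right_right)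
  show m: "eps (- a) = - eps a" for a
    using *(2)[of a "- a"] z by (simp add: eq_neg_iff_add_eq_0 add.commute)
  show "eps (a - b) = eps a - eps b" using *(2)[of a "- b"] m[of b] by simp
  show "eps a = 0 \<longleftrightarrow> a \<in> mm" "\<exists>a. eps a = c"
    using assms by (auto simp: residue_field_def) (metis surjD)
qed

lemma residue_field_module: "residue_field mm eps \<Longrightarrow> module (\<lambda>r c. eps r * c)"
  by unfold_locales (simp_all add: residue_field_hom algebra_simps)

text \<open>A scalar of the ring crosses the tensor sign and acts on k through \<open>eps\<close>.
  Together with \<open>tor_functional_eqI\<close> this lets a functional on Tor be treated as a map
  on \<open>G\<close> that is linear along \<open>eps\<close>.\<close>

lemma
  assumes "\<alpha> \<in> tor_functionals eps G"
  shows tor_functional_tensor: "\<alpha> (tor_tensor eps G z c) = c * \<alpha> (tor_bar eps G z)"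
    and tor_functional_bar_add:
      "\<alpha> (tor_bar eps G (z + w)) = \<alpha> (tor_bar eps G z) + \<alpha> (tor_bar eps G w)"
    and tor_functional_bar_scale: "\<alpha> (tor_bar eps G (scal G a z)) = eps a * \<alpha> (tor_bar eps G z)"
    and tor_functional_bar_zero: "\<alpha> (tor_bar eps G 0) = 0"
proof -
  have *: "\<alpha> (s + t) = \<alpha> s + \<alpha> t" if "s \<in> tor eps G" "t \<in> tor eps G" for s t
    using assms that by (simp add: tor_functionals_def)
  have **: "\<alpha> (tor_tensor eps G z (c * c')) = c * \<alpha> (tor_tensor eps G z c')" for z c c'
    using assms by (simp add: tor_functionals_def)
  show tens: "\<alpha> (tor_tensor eps G z c) = c * \<alpha> (tor_bar eps G z)" for z c
    using **[of z c 1] by (simp add: tor_bar_def)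
  show add: "\<alpha> (tor_bar eps G (z + w)) = \<alpha> (tor_bar eps G z) + \<alpha> (tor_bar eps G w)" for z w
    unfolding tor_bar_def tor_tensor_def pure_tensor_add_left
    by (rule *) (auto simp: tor_def pure_tensor_in_carrier)
  show "\<alpha> (tor_bar eps G (scal G a z)) = eps a * \<alpha> (tor_bar eps G z)"
    using tens[of z "eps a * 1"]
    unfolding tor_bar_def tor_tensor_def pure_tensor_scale_right[of "scal G" "\<lambda>r c. eps r * c" z a 1]
    by simp
  show "\<alpha> (tor_bar eps G 0) = 0"
    using add[of 0 0] by (simp only: add_0 add_cancel_right_right)
qed

lemma tor_functional_eqI:
  assumes "\<alpha> \<in> tor_functionals eps G" "\<beta> \<in> tor_functionals eps G"
    and bar: "\<And>z. \<alpha> (tor_bar eps G z) = \<beta> (tor_bar eps G z)"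
  shows "\<alpha> = \<beta>"
proof
  fix t
  show "\<alpha> t = \<beta> t"
  proof (cases "t \<in> tor eps G")
    case True
    then show ?thesis
      unfolding tor_def
    proof (induction t rule: tensor_carrier_induct)
      case (pure z c)
      then show ?case
        using tor_functional_tensor[OF assms(1)] tor_functional_tensor[OF assms(2)] bar
        by (simp add: tor_tensor_def)
    next
      case (add s t)
      then show ?case using assms(1,2) by (auto simp: tor_functionals_def tor_def)
    qed
  qed (use assms in \<open>auto simp: tor_functionals_def\<close>)
qed

lemma tor_functionals_add:
  "\<alpha> \<in> tor_functionals eps G \<Longrightarrow> \<beta> \<in> tor_functionals eps G \<Longrightarrow> \<alpha> + \<beta> \<in> tor_functionals eps G"
  by (simp add: tor_functionals_def algebra_simps)

lemma tor_functionals_zero: "0 \<in> tor_functionals eps G"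
  by (simp add: tor_functionals_def)

lemma tor_dual_add: "\<alpha> \<in> tor_dual eps G \<Longrightarrow> \<beta> \<in> tor_dual eps G \<Longrightarrow> \<alpha> + \<beta> \<in> tor_dual eps G"
  unfolding tor_dual_def mem_Collect_eq
  by (intro conjI tor_functionals_add; (elim conjE)?)
    (assumption, assumption, erule (1) rev_finite_subset[OF finite_UnI], auto)

lemma tor_dual_zero: "0 \<in> tor_dual eps G"
  by (simp add: tor_dual_def tor_functionals_zero)

lemma tor_dual_deg_subset: "tor_dual_deg eps G d \<subseteq> tor_dual eps G"
proof
  fix \<alpha> assume "\<alpha> \<in> tor_dual_deg eps G d"
  then have "{n. \<exists>z\<in>gr G n. \<alpha> (tor_bar eps G z) \<noteq> 0} \<subseteq> {- d}" "\<alpha> \<in> tor_functionals eps G"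
    by (force simp: tor_dual_deg_def)+
  then show "\<alpha> \<in> tor_dual eps G"
    using finite_subset by (auto simp: tor_dual_def)
qed

lemma sum_fun_apply: "(\<Sum>i\<in>I. f i) x = (\<Sum>i\<in>I. f i x)"
  for f :: "'i \<Rightarrow> 'a \<Rightarrow> 'b::comm_monoid_add"
  by (induction I rule: infinite_finite_induct) auto

text \<open>The component of \<alpha> at \<open>n\<close> is \<alpha> composed with the projection
  of \<open>G\<close> to degree \<open>n\<close>; this composite is bilinear in \<open>z\<close> and
  \<open>c\<close>, so it descends to the tensor product. The index is \<open>- n\<close> because
  dualising reverses degrees, and \<open>S\<close> is the finite set of degrees on which \<alpha> is
  nonzero.\<close>

lemma tor_dual_decompose:
  fixes eps :: "'r::comm_ring_1 \<Rightarrow> 'k::field"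
  assumes res: "residue_field mm eps" and G: "graded_complex G" and \<alpha>: "\<alpha> \<in> tor_dual eps G"
  shows "\<exists>S \<beta>. finite S \<and> (\<forall>n. \<beta> n \<in> tor_dual_deg eps G (- n)) \<and> \<alpha> = (\<Sum>n\<in>S. \<beta> n)"
proof -
  interpret G: graded_complex G by (rule G)
  have \<alpha>f: "\<alpha> \<in> tor_functionals eps G"
    and fin: "finite {n. \<exists>z\<in>gr G n. \<alpha> (tor_bar eps G z) \<noteq> 0}" (is "finite ?S")
    using \<alpha> by (auto simp: tor_dual_def)
  note \<alpha>_simps = tor_functional_bar_add[OF \<alpha>f] tor_functional_bar_scale[OF \<alpha>f] tor_functional_bar_zero[OF \<alpha>f]
  have "\<exists>\<beta>. \<beta> \<in> tor_functionals eps G \<and>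
      (\<forall>z. \<beta> (tor_bar eps G z) = \<alpha> (tor_bar eps G (homog_part G n z)))" for n
  proof -
    let ?\<Phi> = "\<lambda>z c. c * \<alpha> (tor_bar eps G (homog_part G n z))"
    obtain L where
      L: "\<forall>s\<in>tensor_carrier (scal G) (\<lambda>r c. eps r * c). \<forall>t\<in>tensor_carrier (scal G) (\<lambda>r c. eps r * c).
            L (s + t) = L s + L t"
        "\<forall>a b. L (pure_tensor (scal G) (\<lambda>r c. eps r * c) a b) = ?\<Phi> a b"
        "\<forall>t. t \<notin> tensor_carrier (scal G) (\<lambda>r c. eps r * c) \<longrightarrow> L t = 0"
      using tensor_lift[OF residue_field_module[OF res], of ?\<Phi> "scal G" "\<lambda>r c. eps r * c"]
      by (auto simp: G.homog_part_add G.homog_part_scale \<alpha>_simps algebra_simps)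
    then have "L \<in> tor_functionals eps G"
      by (simp add: tor_functionals_def tor_def tor_tensor_def)
    with L(2) show ?thesis
      by (intro exI[of _ L]) (simp add: tor_bar_def tor_tensor_def)
  qed
  then obtain \<beta> where \<beta>: "\<And>n. \<beta> n \<in> tor_functionals eps G"
      "\<And>n z. \<beta> n (tor_bar eps G z) = \<alpha> (tor_bar eps G (homog_part G n z))"
    by metis
  have "\<beta> n \<in> tor_dual_deg eps G (- n)" for n
    using \<beta> by (auto simp: tor_dual_deg_def G.homog_part_homog \<alpha>_simps)
  moreover have "\<alpha> = (\<Sum>n\<in>?S. \<beta> n)"
  proof (rule tor_functional_eqI[OF \<alpha>f])
    show sumf: "(\<Sum>n\<in>?S. \<beta> n) \<in> tor_functionals eps G"
      using fin
      by (rule finite_induct)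
        (simp_all only: sum.empty sum.insert tor_functionals_zero tor_functionals_add \<beta>(1) simp_thms)
    fix z
    show "\<alpha> (tor_bar eps G z) = (\<Sum>n\<in>?S. \<beta> n) (tor_bar eps G z)"
    proof (induction z rule: G.homog_induct)
      case zero
      then show ?case by (simp add: \<alpha>_simps tor_functional_bar_zero[OF sumf])
    next
      case (add a b)
      then show ?case by (simp only: \<alpha>_simps tor_functional_bar_add[OF sumf])
    next
      case (homog m z)
      have "(\<Sum>n\<in>?S. \<beta> n) (tor_bar eps G z) =
          (\<Sum>n\<in>?S. if n = m then \<alpha> (tor_bar eps G z) else 0)"
        unfolding sum_fun_apply \<beta>(2)
        using homog by (intro sum.cong) (auto simp: G.homog_part_homog \<alpha>_simps)
      also have "\<dots> = \<alpha> (tor_bar eps G z)"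
        using fin homog by (subst sum.delta) auto
      finally show ?case ..
    qed
  qed
  ultimately show ?thesis using fin by blast
qed

text \<open>The formulas for both actions concern homogeneous functionals; this passes from them to
  the whole graded dual.\<close>

lemma tor_dual_map_eqI:
  fixes eps :: "'r::comm_ring_1 \<Rightarrow> 'k::field" and f g :: "_ \<Rightarrow> 'b::ab_group_add"
  assumes res: "residue_field mm eps" and G: "graded_complex G"
    and f: "\<forall>\<alpha>\<in>tor_dual eps G. \<forall>\<beta>\<in>tor_dual eps G. f (\<alpha> + \<beta>) = f \<alpha> + f \<beta>"
    and g: "\<forall>\<alpha>\<in>tor_dual eps G. \<forall>\<beta>\<in>tor_dual eps G. g (\<alpha> + \<beta>) = g \<alpha> + g \<beta>"
    and eq: "\<And>m \<alpha>. \<alpha> \<in> tor_dual_deg eps G m \<Longrightarrow> f \<alpha> = g \<alpha>"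
    and \<alpha>: "\<alpha> \<in> tor_dual eps G"
  shows "f \<alpha> = g \<alpha>"
proof -
  obtain S \<beta> where "\<And>n. \<beta> n \<in> tor_dual_deg eps G (- n)" and \<alpha>: "\<alpha> = (\<Sum>n\<in>S. \<beta> n)"
    using tor_dual_decompose[OF res G \<alpha>] by blast
  then have \<beta>: "\<beta> n \<in> tor_dual eps G" "f (\<beta> n) = g (\<beta> n)" for n
    using tor_dual_deg_subset eq by blast+
  have "f 0 = f 0 + f 0" "g 0 = g 0 + g 0"
    using f g tor_dual_zero by (metis add_0)+
  then have 0: "f 0 = 0" "g 0 = 0" by (metis add_cancel_left_right)+
  have "(\<Sum>n\<in>S. \<beta> n) \<in> tor_dual eps G \<and> f (\<Sum>n\<in>S. \<beta> n) = g (\<Sum>n\<in>S. \<beta> n)"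
    by (induction S rule: infinite_finite_induct)
      (simp_all only: sum.infinite sum.empty sum.insert 0 tor_dual_zero tor_dual_add f g \<beta> simp_thms)
  then show ?thesis by (simp add: \<alpha>)
qed

section \<open>The acyclic closure in low degrees\<close>

lemma (in module) span_image_finite:
  assumes "finite I"
  shows "span (f ` I) = {\<Sum>i\<in>I. scale (c i) (f i) | c. True}" (is "_ = ?S")
proof
  have "subspace ?S"
  proof (rule subspaceI)
    show "0 \<in> ?S" by (auto intro!: exI[of _ "\<lambda>_. 0"])
    fix x y a
    assume "x \<in> ?S"
    then obtain c where x: "x = (\<Sum>i\<in>I. scale (c i) (f i))" by auto
    then have "scale a x = (\<Sum>i\<in>I. scale (a * c i) (f i))"
      by (simp add: scale_sum_right)
    then show "scale a x \<in> ?S" by (intro CollectI exI[of _ "\<lambda>i. a * c i"]) simp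
    assume "y \<in> ?S"
    then obtain d where "y = (\<Sum>i\<in>I. scale (d i) (f i))" by auto
    with x have "x + y = (\<Sum>i\<in>I. scale (c i + d i) (f i))"
      by (simp add: scale_left_distrib sum.distrib)
    then show "x + y \<in> ?S" by (intro CollectI exI[of _ "\<lambda>i. c i + d i"]) simp
  qed
  moreover have "f i \<in> ?S" if "i \<in> I" for i
  proof -
    have "(\<Sum>j\<in>I. scale (if j = i then 1 else 0) (f j)) = (\<Sum>j\<in>I. if j = i then f j else 0)"
      by (intro sum.cong) auto
    then show ?thesis
      using assms that by (intro CollectI exI[of _ "\<lambda>j. if j = i then 1 else 0"]) simp
  qed
  ultimately show "span (f ` I) \<subseteq> ?S" by (intro span_minimal) auto
  show "?S \<subseteq> span (f ` I)" by (auto intro!: span_sum span_scale intro: span_base)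
qed

lemma module_mult: "module ((*) :: 'r::comm_ring_1 \<Rightarrow> 'r \<Rightarrow> 'r)"
  by unfold_locales (simp_all add: algebra_simps)

text \<open>A coefficient outside the maximal ideal of a local ring is a unit. Dividing the relation
  by it would express \<open>r i\<close> through the other generators, against irredundancy.\<close>

lemma minimal_generators_relation:
  fixes mm :: "'r::comm_ring_1 set"
  assumes loc: "local_noetherian_ring mm" and gens: "minimal_generators mm e r"
    and rel: "(\<Sum>j=1..e. c j * r j) = 0" and i: "i \<in> {1..e}"
  shows "c i \<in> mm"
proof (rule ccontr)
  assume ci: "c i \<notin> mm"
  interpret R: module "(*) :: 'r \<Rightarrow> 'r \<Rightarrow> 'r" by (rule module_mult)
  \<comment> \<open>The principal ideal of \<open>c i\<close> is not contained in \<open>mm\<close>,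
    and \<open>mm\<close> contains every proper ideal.\<close>
  have "R.span {c i} = UNIV"
    using loc ci R.span_base[of "c i" "{c i}"] unfolding local_noetherian_ring_def by blast
  then obtain u where u: "u * c i = 1"
    unfolding R.span_singleton by (metis rangeE UNIV_I)
  let ?I = "{1..e} - {i}"
  have "(\<Sum>j=1..e. c j * r j) = c i * r i + (\<Sum>j\<in>?I. c j * r j)"
    using i by (intro sum.remove) auto
  then have "c i * r i = - (\<Sum>j\<in>?I. c j * r j)"
    using rel by (simp add: eq_neg_iff_add_eq_0)
  then have "u * (c i * r i) = - u * (\<Sum>j\<in>?I. c j * r j)"
    by simp
  then have "r i = - u * (\<Sum>j\<in>?I. c j * r j)"
    using u by (simp flip: mult.assoc)
  moreover have "- u * (\<Sum>j\<in>?I. c j * r j) \<in> R.span (r ` ?I)"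
    by (intro R.span_scale R.span_sum R.span_base) auto
  ultimately have "r i \<in> R.span (r ` ?I)"
    by simp
  moreover have "r j \<in> R.span (r ` ?I)" if "j \<in> ?I" for j
    using that by (intro R.span_base imageI)
  ultimately have "r ` {1..e} \<subseteq> R.span (r ` ?I)"
    by blast
  then have "R.span (r ` {1..e}) \<subseteq> R.span (r ` ?I)"
    by (intro R.span_minimal) auto
  moreover have "R.span (r ` ?I) \<subseteq> R.span (r ` {1..e})"
    by (intro R.span_mono) auto
  ultimately have "R.span (r ` ?I) = R.span (r ` {1..e})"
    by (rule equalityI[rotated])
  also have "\<dots> = mm"
    using gens unfolding minimal_generators_def by (rule conjunct1)
  finally have "R.span (r ` ?I) = mm" .
  moreover have "\<forall>I. I \<subset> {1..e} \<longrightarrow> R.span (r ` I) \<noteq> mm"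
    using gens unfolding minimal_generators_def by (rule conjunct2)
  moreover have "?I \<subset> {1..e}" using i by blast
  ultimately show False by blast
qed

section \<open>The monomial basis and exactness of the acyclic closure\<close>

locale acyclic_closure_of =
  fixes mm :: "'r::comm_ring_1 set"
    and F :: "('r, 'f::ring_1, 'v::linorder) gamma_data"
  assumes acyclic_closure: "acyclic_closure mm F"
begin

lemma dg_algebra: "dg_algebra F"
  and divided_powers: "divided_powers F"
  and var_gr: "v \<in> Vars F \<Longrightarrow> var F v \<in> gr F (int (vdeg F v))"
  and vdeg_pos: "v \<in> Vars F \<Longrightarrow> vdeg F v > 0"
  and independent_monomials: "\<not> module.dependent (scal F) (monomial F ` exponents F)"
  and span_monomials: "module.span (scal F) (monomial F ` exponents F) = UNIV"
  and cycles_killed: "module.span (scal F) ((\<lambda>v. bd F (var F v)) ` {v \<in> Vars F. vdeg F v = Suc n} \<union>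
    upto_boundaries F n) = cycles_to_kill mm F n"
proof -
  note ac = acyclic_closure[unfolded acyclic_closure_def Let_def]
  note ac2 = conjunct2[OF ac]
  note ac3 = conjunct2[OF ac2]
  note ac5 = conjunct2[OF conjunct2[OF ac3]]
  note ac6 = conjunct2[OF ac5]
  show "dg_algebra F" by (rule conjunct1[OF ac])
  show "divided_powers F" by (rule conjunct1[OF ac2])
  show "v \<in> Vars F \<Longrightarrow> var F v \<in> gr F (int (vdeg F v))" "v \<in> Vars F \<Longrightarrow> vdeg F v > 0"
    using conjunct1[OF ac3] by simp_all
  show "\<not> module.dependent (scal F) (monomial F ` exponents F)" by (rule conjunct1[OF ac5])
  show "module.span (scal F) (monomial F ` exponents F) = UNIV" by (rule conjunct1[OF ac6])
  show "module.span (scal F) ((\<lambda>v. bd F (var F v)) ` {v \<in> Vars F. vdeg F v = Suc n} \<union>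
    upto_boundaries F n) = cycles_to_kill mm F n"
    by (rule conjunct1[OF spec[OF conjunct2[OF ac6]]])
qed

sublocale graded_complex F
  using dg_algebra by (intro graded_complex.intro) (simp add: dg_algebra_def)

lemma scal_mult_left: "scal F r (a * b) = scal F r a * b"
  and scal_mult_right: "scal F r (a * b) = a * scal F r b"
  and one_gr: "1 \<in> gr F 0"
  and mult_gr: "a \<in> gr F i \<Longrightarrow> b \<in> gr F j \<Longrightarrow> a * b \<in> gr F (i + j)"
  and bd_mult: "a \<in> gr F i \<Longrightarrow> bd F (a * b) = bd F a * b + ksign i (a * bd F b)"
proof -
  note * = dg_algebra[unfolded dg_algebra_def]
  have "\<forall>r a b. scal F r (a * b) = scal F r a * b \<and> scal F r (a * b) = a * scal F r b"
    using * by (elim conjE)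
  then show "scal F r (a * b) = scal F r a * b" "scal F r (a * b) = a * scal F r b"
    by metis+
  show "1 \<in> gr F 0"
    using * by (elim conjE)
  have "\<forall>i j a b. a \<in> gr F i \<and> b \<in> gr F j \<longrightarrow> a * b \<in> gr F (i + j) \<and> a * b = ksign (i * j) (b * a)"
    using * by (elim conjE)
  then show "a \<in> gr F i \<Longrightarrow> b \<in> gr F j \<Longrightarrow> a * b \<in> gr F (i + j)"
    by blast
  have "\<forall>i a b. a \<in> gr F i \<longrightarrow> bd F (a * b) = bd F a * b + ksign i (a * bd F b)"
    using * by (elim conjE)
  then show "a \<in> gr F i \<Longrightarrow> bd F (a * b) = bd F a * b + ksign i (a * bd F b)"
    by blast
qed

lemma dpow_gr: "even m \<Longrightarrow> m > 0 \<Longrightarrow> a \<in> gr F m \<Longrightarrow> dpow F i a \<in> gr F (int i * m)"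
proof -
  assume "even m" "m > 0" "a \<in> gr F m"
  then have "even m \<and> m > 0 \<and> a \<in> gr F m" by simp
  note dp = mp[OF spec[OF spec[OF conjunct1[OF divided_powers[unfolded divided_powers_def]]]] this]
  show ?thesis
    by (rule spec[OF conjunct1[OF conjunct2[OF conjunct2[OF dp]]]])
qed

definition mdeg :: "('v \<Rightarrow> nat) \<Rightarrow> nat" where
  "mdeg a = (\<Sum>v | a v \<noteq> 0. a v * vdeg F v)"

lemma monomial_gr:
  assumes "a \<in> exponents F"
  shows "monomial F a \<in> gr F (int (mdeg a))"
proof -
  let ?x = "\<lambda>v. if odd (vdeg F v) then var F v else dpow F (a v) (var F v)"
  have a: "finite {v. a v \<noteq> 0}" "{v. a v \<noteq> 0} \<subseteq> Vars F" "\<And>v. odd (vdeg F v) \<Longrightarrow> a v \<le> 1"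
    using assms by (auto simp: exponents_def)
  have x: "?x v \<in> gr F (int (a v * vdeg F v))" if v: "a v \<noteq> 0" for v
  proof -
    have "v \<in> Vars F" using a(2) v by auto
    then have "var F v \<in> gr F (int (vdeg F v))" "vdeg F v > 0" by (rule var_gr vdeg_pos)+
    \<comment> \<open>An odd variable enters \<open>monomial\<close> as itself, whatever its
      exponent. The degree comes out right because an odd variable that occurs has exponent exactly
      1.\<close>
    moreover have "a v = 1" if "odd (vdeg F v)" using a(3)[OF that] v by simp
    ultimately show ?thesis using dpow_gr[of "int (vdeg F v)" "var F v" "a v"] by simp
  qed
  have "prod_list (map ?x vs) \<in> gr F (int (\<Sum>v\<leftarrow>vs. a v * vdeg F v))"
    if "set vs \<subseteq> {v. a v \<noteq> 0}" for vs
    using that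
  proof (induction vs)
    case (Cons v vs)
    then show ?case using mult_gr[OF x[of v] Cons.IH] by simp
  qed (simp add: one_gr)
  from this[of "sorted_list_of_set {v. a v \<noteq> 0}"] show ?thesis
    using a(1) by (simp add: monomial_def mdeg_def sum_list_distinct_conv_sum_set)
qed

text \<open>Monomials are homogeneous and span everything, so projecting to degree \<open>n\<close>
  keeps those of degree \<open>n\<close> and sends the others to 0.\<close>

lemma gr_eq_span: "gr F (int n) = span (monomial F ` {a \<in> exponents F. mdeg a = n})" (is "_ = span ?B")
proof
  show "span ?B \<subseteq> gr F (int n)"
    by (rule span_minimal[OF _ subspace_gr]) (use monomial_gr in auto)
  show "gr F (int n) \<subseteq> span ?B"
  proof
    fix z assume z: "z \<in> gr F (int n)"
    have "homog_part F n ` span (monomial F ` exponents F) =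
        span (homog_part F n ` monomial F ` exponents F)"
      by (rule module_hom.span_image[OF module_hom_homog_part, symmetric])
    then have "homog_part F n z \<in> span (homog_part F n ` monomial F ` exponents F)"
      unfolding span_monomials by auto
    moreover have "homog_part F n ` monomial F ` exponents F \<subseteq> insert 0 ?B"
      by (auto simp: homog_part_homog[OF monomial_gr])
    then have "homog_part F n ` monomial F ` exponents F \<subseteq> span ?B"
      by (rule order_trans) (simp add: span_zero span_superset)
    then have "span (homog_part F n ` monomial F ` exponents F) \<subseteq> span ?B"
      by (rule span_minimal) simp
    ultimately show "z \<in> span ?B" using z by (auto simp: homog_part_homog)
  qed
qed

lemma free_gr: "free_submodule (scal F) (gr F n)"
proof (cases "n < 0")
  case True
  then show ?thesis
    unfolding free_submodule_def by (intro exI[of _ "{}"]) (simp add: gr_neg independent_empty)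
next
  case False
  have "\<not> dependent (monomial F ` {a \<in> exponents F. mdeg a = nat n})"
    by (rule independent_mono[OF independent_monomials]) auto
  then show ?thesis
    unfolding free_submodule_def using gr_eq_span[of "nat n"] False
    by (intro exI[of _ "monomial F ` {a \<in> exponents F. mdeg a = nat n}"]) simp
qed

text \<open>A variable that occurs in a monomial has at most the degree of the monomial. Hence the
  cycles of \<open>F\<close> in degree n are already the cycles that \<open>cycles_to_kill\<close>
  speaks of.\<close>

lemma gr_upto_subalgebra: "gr F (int n) \<subseteq> upto_subalgebra F n"
proof -
  have "vdeg F v \<le> mdeg a" if "a \<in> exponents F" "a v \<noteq> 0" for a v
  proof -
    have "a v * vdeg F v \<le> mdeg a"
      unfolding mdeg_def using that by (intro member_le_sum) (auto simp: exponents_def)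
    moreover have "vdeg F v \<le> a v * vdeg F v" using that(2) by simp
    ultimately show ?thesis by (rule le_trans[rotated])
  qed
  then show ?thesis
    unfolding gr_eq_span upto_subalgebra_def by (intro span_mono) auto
qed

text \<open>The cycles to be killed are spanned by the boundaries of the variables of degree n + 1
  and by boundaries already present below; both kinds are boundaries in \<open>F\<close>.\<close>

lemma acyclic:
  assumes "n > 0" "z \<in> gr F n" "bd F z = 0"
  shows "z \<in> bd F ` gr F (n + 1)"
proof -
  define m where "m = nat n"
  have n: "n = int m" using assms(1) by (simp add: m_def)
  have "z \<in> cycles_to_kill mm F m"
    using assms gr_upto_subalgebra[of m] by (auto simp: cycles_to_kill_def n)
  also have "\<dots> \<subseteq> bd F ` gr F (n + 1)"
    unfolding cycles_killed[symmetric]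
  proof (rule span_minimal)
    show "subspace (bd F ` gr F (n + 1))" by (rule bd.subspace_image[OF subspace_gr])
    have "var F v \<in> gr F (n + 1)" if "v \<in> Vars F" "vdeg F v = Suc m" for v
      using var_gr[OF that(1)] by (simp add: that n algebra_simps)
    then show "(\<lambda>v. bd F (var F v)) ` {v \<in> Vars F. vdeg F v = Suc m} \<union> upto_boundaries F m
        \<subseteq> bd F ` gr F (n + 1)"
      by (auto simp: upto_boundaries_def n)
  qed
  finally show ?thesis .
qed

lemma one_in_monomials: "1 \<in> monomial F ` exponents F"
  by (rule image_eqI[of _ _ "\<lambda>_. 0"]) (simp_all add: monomial_def exponents_def)

text \<open>The unit is the empty monomial, hence a member of a basis. Together with
  \<open>gr_0_eq\<close> this identifies degree 0 of \<open>F\<close> with the ring, so coefficients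
  can be compared there.\<close>

lemma scal_one_inj: "scal F a 1 = scal F b 1 \<longleftrightarrow> a = b"
proof
  assume "scal F a 1 = scal F b 1"
  then have "(\<Sum>v\<in>{1}. scal F ((\<lambda>_. a - b) v) v) = 0" by (simp add: scale_left_diff_distrib)
  then have "a - b = 0"
    by (rule independentD[OF independent_monomials, rotated 2]) (use one_in_monomials in auto)
  then show "a = b" by simp
qed simp

lemma mdeg_0D:
  assumes "a \<in> exponents F" "mdeg a = 0"
  shows "a = (\<lambda>_. 0)"
proof
  fix v
  have "finite {v. a v \<noteq> 0}" "{v. a v \<noteq> 0} \<subseteq> Vars F"
    using assms by (auto simp: exponents_def)
  then show "a v = 0"
    using assms(2) vdeg_pos by (fastforce simp: mdeg_def)
qed

lemma gr_0_eq: "gr F 0 = range (\<lambda>a. scal F a 1)"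
proof -
  have 0: "(\<lambda>_. 0) \<in> exponents F" "mdeg (\<lambda>_. 0) = 0"
    by (simp_all add: exponents_def mdeg_def)
  have "{a \<in> exponents F. mdeg a = 0} = {\<lambda>_. 0}"
    using mdeg_0D 0 by blast
  then show ?thesis
    using gr_eq_span[of 0] by (simp add: span_singleton monomial_def)
qed

lemma mdeg_1D:
  assumes a: "a \<in> exponents F" "mdeg a = 1"
  shows "\<exists>v\<in>Vars F. vdeg F v = 1 \<and> monomial F a = var F v"
proof -
  have fin: "finite {v. a v \<noteq> 0}" and sub: "{v. a v \<noteq> 0} \<subseteq> Vars F"
    using a by (auto simp: exponents_def)
  have ge: "1 \<le> a v * vdeg F v" if "a v \<noteq> 0" for v
    using vdeg_pos[of v] that sub by (auto simp: Suc_le_eq)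
  \<comment> \<open>Every variable that occurs contributes at least 1 to the degree, so in degree 1
    exactly one occurs, with exponent 1.\<close>
  have "card {v. a v \<noteq> 0} \<le> mdeg a"
    unfolding mdeg_def using sum_mono[of "{v. a v \<noteq> 0}" "\<lambda>_. 1" "\<lambda>v. a v * vdeg F v"] ge by simp
  moreover have "{v. a v \<noteq> 0} \<noteq> {}"
  proof
    assume "{v. a v \<noteq> 0} = {}"
    then have "mdeg a = 0" unfolding mdeg_def by (simp only: sum.empty)
    then show False using a(2) by simp
  qed
  ultimately have "card {v. a v \<noteq> 0} = 1"
    using fin a(2) by (metis card_0_eq le_antisym less_one not_le)
  then obtain v where v: "{v. a v \<noteq> 0} = {v}" by (rule card_1_singletonE)
  then have "a v * vdeg F v = 1" using a(2) by (simp add: mdeg_def)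
  then have "vdeg F v = 1" by simp
  moreover have "v \<in> Vars F" using sub v by auto
  ultimately show ?thesis using v by (intro bexI[of _ v]) (simp_all add: monomial_def)
qed

lemma gr_1_subset: "gr F 1 \<subseteq> span (var F ` {v \<in> Vars F. vdeg F v = 1})"
proof -
  have "monomial F ` {a \<in> exponents F. mdeg a = 1} \<subseteq> var F ` {v \<in> Vars F. vdeg F v = 1}"
    using mdeg_1D by fastforce
  then show ?thesis using gr_eq_span[of 1] span_mono by simp
qed

end

section \<open>The action of derivations\<close>

locale residue_resolution = acyclic_closure_of mm F + G: graded_complex G
  for mm :: "'r::comm_ring_1 set"
    and F :: "('r, 'f::ring_1, 'v::linorder) gamma_data"
    and G :: "('r, 'g::ab_group_add) complex_data" +
  fixes eps :: "'r \<Rightarrow> 'k::field" and aug :: "'f \<Rightarrow> 'k"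
    and e :: nat and r :: "nat \<Rightarrow> 'r" and x :: "nat \<Rightarrow> 'v"
  assumes local: "local_noetherian_ring mm"
    and residue: "residue_field mm eps"
    and augmentation: "augmentation eps F aug"
    and free_G: "free_submodule (scal G) (gr G n)"
    and minimal_G: "bd G z \<in> module.span (scal G) {scal G a w | a w. a \<in> mm}"
    and generators: "minimal_generators mm e r"
    and x: "bij_betw x {1..e} {v \<in> Vars F. vdeg F v = 1}"
    and bd_x: "i \<in> {1..e} \<Longrightarrow> bd F (var F (x i)) = scal F (r i) 1"
begin

lemmas eps_simps = residue_field_hom(1-6)[OF residue]
lemmas eps_eq_0_iff = residue_field_hom(7)[OF residue]
lemmas eps_surj = residue_field_hom(8)[OF residue]

lemma eps_ksign: "eps (ksign n a) = ksign n (eps a)"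
  by (simp add: ksign_def eps_simps)

lemma x_gr: "i \<in> {1..e} \<Longrightarrow> var F (x i) \<in> gr F 1"
  using bij_betwE[OF x] var_gr[of "x i"] by fastforce

lemma gr_1_coords:
  assumes "z \<in> gr F 1"
  shows "\<exists>c. z = (\<Sum>j=1..e. scal F (c j) (var F (x j)))"
proof -
  have "z \<in> span (var F ` x ` {1..e})"
    using gr_1_subset assms bij_betw_imp_surj_on[OF x] by auto
  then have "z \<in> span ((\<lambda>j. var F (x j)) ` {1..e})"
    by (simp only: image_image)
  then show ?thesis
    unfolding span_image_finite[OF finite_atLeastAtMost] by blast
qed

lemma mm_coords:
  assumes "a \<in> mm"
  shows "\<exists>c. a = (\<Sum>j=1..e. c j * r j)"
proof -
  have "a \<in> module.span (*) (r ` {1..e})"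
    using assms generators by (simp add: minimal_generators_def)
  then show ?thesis
    unfolding module.span_image_finite[OF module_mult finite_atLeastAtMost] by blast
qed

lemma mm_boundary:
  assumes "a \<in> mm"
  shows "scal F a 1 \<in> bd F ` gr F 1"
proof -
  obtain c where c: "a = (\<Sum>j=1..e. c j * r j)" using mm_coords[OF assms] by blast
  have "scal F a 1 = (\<Sum>j=1..e. scal F (c j) (bd F (var F (x j))))"
    unfolding c scale_sum_left by (intro sum.cong) (auto simp: bd_x)
  also have "\<dots> = bd F (\<Sum>j=1..e. scal F (c j) (var F (x j)))"
    by (simp add: bd.sum bd.scale)
  finally show ?thesis
    using x_gr by (auto intro!: subspace_sum[OF subspace_gr] subspace_scale[OF subspace_gr])
qed

section \<open>The augmentation and the lifting of functionals\<close>

lemma aug_add: "aug (a + b) = aug a + aug b"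
  and aug_one: "aug (scal F c 1) = eps c"
  and aug_gr: "z \<in> gr F n \<Longrightarrow> n \<noteq> 0 \<Longrightarrow> aug z = 0"
  using augmentation by (auto simp: augmentation_def image_subset_iff)

text \<open>Linearity is derived from additivity: degree 0 consists of multiples of the unit, where
  \<open>aug\<close> is given by \<open>eps\<close>, and all other degrees are sent to 0.\<close>

lemma aug_scale: "aug (scal F c a) = eps c * aug a"
proof (induction a rule: homog_induct)
  case zero
  have "aug 0 = 0" using aug_add[of 0 0] by (simp only: add_0 add_cancel_right_right)
  then show ?case by simp
next
  case (homog n z)
  show ?case
  proof (cases "n = 0")
    case True
    then obtain b where "z = scal F b 1" using homog gr_0_eq by auto
    then show ?thesis by (simp add: aug_one eps_simps)
  next
    case False
    have "aug z = 0" by (rule aug_gr[OF homog False])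
    moreover have "aug (scal F c z) = 0"
      by (rule aug_gr[OF subspace_scale[OF subspace_gr homog] False])
    ultimately show ?thesis by simp
  qed
qed (simp add: aug_add scale_right_distrib algebra_simps)

lemma module_hom_aug: "module_hom (scal F) (\<lambda>c b. eps c * b) aug"
  by (intro module_hom.intro module_scal residue_field_module[OF residue] module_hom_axioms.intro
      aug_add aug_scale)

text \<open>Exactness at the bottom: an element of degree 0 killed by \<open>aug\<close> has its
  coefficient in \<open>mm\<close>, which is generated by the boundaries of the variables of degree
  1.\<close>

lemma aug_kernel: "z \<in> gr F 0 \<Longrightarrow> aug z = 0 \<Longrightarrow> z \<in> bd F ` gr F 1"
  using mm_boundary by (auto simp: gr_0_eq aug_one eps_eq_0_iff)

text \<open>By minimality a boundary of \<open>G\<close> is a combination of elements with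
  coefficients in \<open>mm\<close>, and these coefficients act as 0 on k.\<close>

lemma tor_functional_bd:
  assumes "\<alpha> \<in> tor_functionals eps G"
  shows "\<alpha> (tor_bar eps G (bd G z)) = 0"
proof -
  have "\<alpha> (tor_bar eps G w) = 0" if "w \<in> G.span {scal G a w | a w. a \<in> mm}" for w
    using that
  proof (induction w rule: G.span_induct)
    case base
    show ?case
      by (rule G.subspaceI)
        (simp_all add: tor_functional_bar_zero[OF assms] tor_functional_bar_add[OF assms]
          tor_functional_bar_scale[OF assms])
  next
    case (step w)
    then show ?case using tor_functional_bar_scale[OF assms] by (auto simp: eps_eq_0_iff[symmetric])
  qed
  then show ?thesis using minimal_G by blast
qed

lemma tor_dual_deg_lift:
  assumes \<alpha>: "\<alpha> \<in> tor_dual_deg eps G m"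
  shows "\<exists>\<psi>. module_hom (scal G) (scal F) \<psi> \<and> (\<forall>n. \<psi> ` gr G n \<subseteq> gr F (n + m)) \<and>
    (\<forall>z. bd F (\<psi> z) = ksign m (\<psi> (bd G z))) \<and> (\<forall>z. aug (\<psi> z) = \<alpha> (tor_bar eps G z))"
proof -
  have \<alpha>f: "\<alpha> \<in> tor_functionals eps G"
    and \<alpha>0: "\<And>n z. n + m \<noteq> 0 \<Longrightarrow> z \<in> gr G n \<Longrightarrow> \<alpha> (tor_bar eps G z) = 0"
    using \<alpha> by (auto simp: tor_dual_deg_def)
  let ?w = "\<lambda>z. \<alpha> (tor_bar eps G z)"
  note w = tor_functional_bar_zero[OF \<alpha>f] tor_functional_bar_add[OF \<alpha>f] tor_functional_bar_scale[OF \<alpha>f]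
  have "?w ` gr G (- m) \<subseteq> aug ` gr F 0"
  proof safe
    fix z
    obtain a where "eps a = ?w z" using eps_surj by blast
    then show "?w z \<in> aug ` gr F 0"
      by (intro image_eqI[of _ _ "scal F a 1"]) (simp_all add: gr_0_eq aug_one)
  qed
  moreover have "linear_on (scal G) (\<lambda>c b. eps c * b) (gr G (- m)) ?w"
    by (simp add: linear_on_def w)
  \<comment> \<open>The bottom map lifts \<alpha> through the surjection from degree 0 of
    \<open>F\<close> onto k.\<close>
  ultimately have "\<exists>h0. linear_on (scal G) (scal F) (gr G (- m)) h0 \<and>
      h0 ` gr G (- m) \<subseteq> gr F 0 \<and> (\<forall>z\<in>gr G (- m). aug (h0 z) = ?w z)"
    by (intro free_lift[OF free_G G.module_scal module_hom_aug subspace_gr])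
  then obtain h0 where h0: "linear_on (scal G) (scal F) (gr G (- m)) h0"
      "h0 ` gr G (- m) \<subseteq> gr F 0" "\<forall>z\<in>gr G (- m). aug (h0 z) = ?w z"
    by blast
  \<comment> \<open>The functional vanishes on \<open>bd G z\<close>, so \<open>h0 (bd G z)\<close>
    lies in the kernel of \<open>aug\<close> and is therefore a boundary.\<close>
  have h1: "0 + ksign m (h0 (bd G z)) \<in> bd F ` gr F 1" if "z \<in> gr G (1 - m)" for z
  proof -
    have z: "bd G z \<in> gr G (- m)" using G.bd_gr[OF that] by simp
    then have "h0 (bd G z) \<in> bd F ` gr F 1"
      using h0 tor_functional_bd[OF \<alpha>f] by (intro aug_kernel) auto
    then show ?thesis
      unfolding add_0 by (rule ksign_mem[OF module_scal bd.subspace_image[OF subspace_gr]])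
  qed
  have u: "module_hom (scal G) (scal F) (\<lambda>_. 0)"
    by (intro module_pair.module_hom_zero module_pair.intro module_scal G.module_scal)
  have "\<exists>h. module_hom (scal G) (scal F) h \<and> (\<forall>n. h ` gr G n \<subseteq> gr F (n + m)) \<and>
     (\<forall>z. bd F (h z) = 0 + ksign m (h (bd G z))) \<and> (\<forall>z\<in>gr G (- m). h z = h0 z)"
    by (rule chain_lift[OF G.graded_complex_axioms graded_complex_axioms free_G acyclic u _ _
          h0(1,2) h1]) (simp_all add: gr_0)
  then obtain \<psi> where \<psi>: "module_hom (scal G) (scal F) \<psi>" "\<And>n. \<psi> ` gr G n \<subseteq> gr F (n + m)"
      "\<And>z. bd F (\<psi> z) = ksign m (\<psi> (bd G z))" "\<And>z. z \<in> gr G (- m) \<Longrightarrow> \<psi> z = h0 z"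
    unfolding add_0 by blast
  have "aug (\<psi> z) = ?w z" for z
  proof (induction z rule: G.homog_induct)
    case zero
    then show ?case
      by (simp add: module_hom.zero[OF \<psi>(1)] module_hom.zero[OF module_hom_aug] w)
  next
    case (add a b)
    then show ?case by (simp add: module_hom.add[OF \<psi>(1)] aug_add w)
  next
    case (homog n z)
    show ?case
    proof (cases "n = - m")
      case True
      then show ?thesis using \<psi>(4) h0(3) homog by simp
    next
      case False
      then have "n + m \<noteq> 0" by simp
      moreover have "\<psi> z \<in> gr F (n + m)" using \<psi>(2) homog by blast
      ultimately show ?thesis using aug_gr \<alpha>0[OF _ homog] by simp
    qed
  qed
  with \<psi> show ?thesis by blast
qed

text \<open>The Herzog-Iyengar formula presupposes such an expansion of the boundary. Each
  coefficient from \<open>mm\<close> is expanded in the generators \<open>r j\<close>, and the terms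
  are collected by generator.\<close>

lemma bd_coords:
  assumes "z \<in> gr G n"
  shows "\<exists>f. (\<forall>j\<in>{1..e}. f j \<in> gr G (n - 1)) \<and> bd G z = (\<Sum>j=1..e. scal G (r j) (f j))"
proof -
  let ?T = "{\<Sum>j=1..e. scal G (r j) (f j) | f. True}"
  have "G.span {scal G a w | a w. a \<in> mm} \<subseteq> ?T"
  proof (rule G.span_minimal)
    show "{scal G a w | a w. a \<in> mm} \<subseteq> ?T"
    proof safe
      fix a w assume "a \<in> mm"
      then obtain c where c: "a = (\<Sum>j=1..e. c j * r j)" using mm_coords by blast
      have "scal G a w = (\<Sum>j=1..e. scal G (r j) (scal G (c j) w))"
        unfolding c G.scale_sum_left by (simp add: mult.commute)
      then show "\<exists>f. scal G a w = (\<Sum>j=1..e. scal G (r j) (f j)) \<and> True"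
        by (intro exI[of _ "\<lambda>j. scal G (c j) w"]) simp
    qed
    show "G.subspace ?T"
    proof (rule G.subspaceI)
      show "0 \<in> ?T" by (auto intro!: exI[of _ "\<lambda>_. 0"])
      fix u v a assume "u \<in> ?T"
      then obtain f where u: "u = (\<Sum>j=1..e. scal G (r j) (f j))" by auto
      then have "scal G a u = (\<Sum>j=1..e. scal G (r j) (scal G a (f j)))"
        by (simp add: G.scale_sum_right mult.commute)
      then show "scal G a u \<in> ?T" by (intro CollectI exI[of _ "\<lambda>j. scal G a (f j)"]) simp
      assume "v \<in> ?T"
      then obtain g where "v = (\<Sum>j=1..e. scal G (r j) (g j))" by auto
      with u have "u + v = (\<Sum>j=1..e. scal G (r j) (f j + g j))"
        by (simp add: G.scale_right_distrib sum.distrib)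
      then show "u + v \<in> ?T" by (intro CollectI exI[of _ "\<lambda>j. f j + g j"]) simp
    qed
  qed
  then obtain f where f: "bd G z = (\<Sum>j=1..e. scal G (r j) (f j))"
    using minimal_G[of z] by blast
  \<comment> \<open>The \<open>f j\<close> obtained from the span need not be homogeneous.
    Projecting to degree \<open>n - 1\<close> fixes the boundary and commutes with scalars, so it
    repairs them.\<close>
  have "bd G z = homog_part G (n - 1) (bd G z)"
    using G.bd_gr[OF assms] by (simp add: G.homog_part_homog)
  also have "\<dots> = (\<Sum>j=1..e. scal G (r j) (homog_part G (n - 1) (f j)))"
    unfolding f by (simp add: module_hom.sum[OF G.module_hom_homog_part] G.homog_part_scale)
  finally show ?thesis
    by (intro exI[of _ "\<lambda>j. homog_part G (n - 1) (f j)"]) (simp add: G.homog_part_props)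
qed

text \<open>Compare the two expressions for \<open>\<partial>\<psi>(z)\<close> in \<open>F\<^sub>0 = R\<close>: the coefficients of the \<open>r\<^sub>j\<close> agree
  modulo the maximal ideal, by minimality of the generators.\<close>

lemma aug_derivation_lift:
  assumes \<psi>: "module_hom (scal G) (scal F) \<psi>" "\<And>n. \<psi> ` gr G n \<subseteq> gr F (n + m)"
    "\<And>z. bd F (\<psi> z) = ksign m (\<psi> (bd G z))"
    and \<theta>: "module_hom (scal F) (scal F) \<theta>" "\<And>j. j \<in> {1..e} \<Longrightarrow> \<theta> (var F (x j)) = (if i = j then 1 else 0)"
    and i: "i \<in> {1..e}" and z: "z \<in> gr G (1 - m)"
    and f: "\<And>j. j \<in> {1..e} \<Longrightarrow> f j \<in> gr G (- m)" "bd G z = (\<Sum>j=1..e. scal G (r j) (f j))"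
  shows "aug (\<theta> (\<psi> z)) = ksign m (aug (\<psi> (f i)))"
proof -
  interpret \<psi>: module_hom "scal G" "scal F" \<psi> by (rule \<psi>)
  interpret \<theta>: module_hom "scal F" "scal F" \<theta> by (rule \<theta>)
  have "\<psi> z \<in> gr F (1 - m + m)" using \<psi>(2) z by blast
  then obtain c where c: "\<psi> z = (\<Sum>j=1..e. scal F (c j) (var F (x j)))"
    using gr_1_coords by auto
  have "\<forall>j\<in>{1..e}. \<exists>b. \<psi> (f j) = scal F b 1"
    using \<psi>(2)[of "- m"] f(1) gr_0_eq by fastforce
  then obtain b where b: "\<And>j. j \<in> {1..e} \<Longrightarrow> \<psi> (f j) = scal F (b j) 1" by metis
  have "bd F (\<psi> z) = (\<Sum>j=1..e. scal F (c j * r j) 1)"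
    unfolding c bd.sum by (intro sum.cong) (auto simp: bd.scale bd_x)
  moreover have "\<psi> (bd G z) = (\<Sum>j=1..e. scal F (b j * r j) 1)"
    unfolding f(2) \<psi>.sum by (intro sum.cong) (auto simp: \<psi>.scale b mult.commute)
  ultimately have "scal F (\<Sum>j=1..e. c j * r j) 1 = scal F (\<Sum>j=1..e. ksign m (b j) * r j) 1"
    using \<psi>(3)[of z] by (cases "even m") (simp_all add: scale_sum_left ksign_def sum_negf)
  then have "(\<Sum>j=1..e. c j * r j) = (\<Sum>j=1..e. ksign m (b j) * r j)"
    by (simp only: scal_one_inj)
  then have "(\<Sum>j=1..e. (c j - ksign m (b j)) * r j) = 0"
    by (simp add: left_diff_distrib sum_subtractf)
  then have "c i - ksign m (b i) \<in> mm"
    by (rule minimal_generators_relation[OF local generators _ i])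
  then have "eps (c i) = ksign m (eps (b i))"
    by (simp add: eps_eq_0_iff[symmetric] eps_simps eps_ksign)
  moreover have "\<theta> (\<psi> z) = scal F (c i) 1"
  proof -
    have "\<theta> (\<psi> z) = (\<Sum>j=1..e. if j = i then scal F (c j) 1 else 0)"
      unfolding c \<theta>.sum by (intro sum.cong) (auto simp: \<theta>.scale \<theta>(2))
    then show ?thesis using i by simp
  qed
  ultimately show ?thesis by (simp add: aug_one b[OF i])
qed

lemma homF_of_module_hom:
  assumes \<phi>: "module_hom (scal G) (scal F) \<phi>" "\<And>n. \<phi> ` gr G n \<subseteq> gr F (n + d)"
  shows "\<exists>\<Psi>\<in>homF G F d. \<forall>g f. \<Psi> (GF_tensor G F g f) = \<phi> g * f"
proof -
  interpret \<phi>: module_hom "scal G" "scal F" \<phi> by (rule \<phi>)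
  obtain L where
    "\<forall>s\<in>tensor_carrier (scal G) (scal F). \<forall>t\<in>tensor_carrier (scal G) (scal F). L (s + t) = L s + L t"
    "\<forall>g f. L (pure_tensor (scal G) (scal F) g f) = \<phi> g * f"
    using tensor_lift[OF module_scal, of "\<lambda>g f. \<phi> g * f" "scal G" "scal F"]
    by (auto simp: \<phi>.add \<phi>.scale scal_mult_left[symmetric] scal_mult_right[symmetric] algebra_simps)
  moreover have "\<phi> g * f \<in> gr F (i + j + d)" if "g \<in> gr G i" "f \<in> gr F j" for i j g f
  proof -
    have "\<phi> g \<in> gr F (i + d)" using \<phi>(2) that by blast
    from mult_gr[OF this that(2)] show ?thesis by (simp add: algebra_simps)
  qed
  ultimately show ?thesis
    by (intro bexI[of _ L]) (auto simp: homF_def GF_tensor_def mult.assoc)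
qed

lemma ksign_mult_left: "ksign n a * b = ksign n (a * b)" for a b :: 'f
  by (simp add: ksign_def)

text \<open>Supplies every witness that \<open>lie_acts\<close> asks for. In
  \<open>\<beta>_bar\<close> the two minus signs, one from the right action and one from the
  antipode, have already cancelled, leaving the sign (-1)^m that \<open>aug_derivation_lift\<close>
  also produces.\<close>

lemma lie_acts_degree_one:
  assumes \<theta>: "\<theta> \<in> der_cycles F (-1)" "\<theta> \<in> \<xi>"
      "\<And>j. j \<in> {1..e} \<Longrightarrow> \<theta> (var F (x j)) = (if i = j then 1 else 0)"
    and i: "i \<in> {1..e}"
    and \<alpha>: "\<alpha> \<in> tor_dual_deg eps G m" and \<beta>: "\<beta> \<in> tor_dual_deg eps G (m - 1)"
    and \<beta>_bar: "\<And>z f. z \<in> gr G (1 - m) \<Longrightarrow> (\<And>j. j \<in> {1..e} \<Longrightarrow> f j \<in> gr G (- m)) \<Longrightarrow>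
      bd G z = (\<Sum>j=1..e. scal G (r j) (f j)) \<Longrightarrow>
      \<beta> (tor_bar eps G z) = ksign m (\<alpha> (tor_bar eps G (f i)))"
  shows "lie_acts eps aug G F (-1) \<xi> \<alpha> \<beta>"
proof -
  obtain \<psi> where \<psi>: "module_hom (scal G) (scal F) \<psi>" "\<And>n. \<psi> ` gr G n \<subseteq> gr F (n + m)"
      "\<And>z. bd F (\<psi> z) = ksign m (\<psi> (bd G z))" "\<And>z. aug (\<psi> z) = \<alpha> (tor_bar eps G z)"
    using tor_dual_deg_lift[OF \<alpha>] by blast
  interpret \<psi>: module_hom "scal G" "scal F" \<psi> by (rule \<psi>)
  have \<psi>_gr: "\<psi> g \<in> gr F (n + m)" if "g \<in> gr G n" for g n
    using \<psi>(2) that by blast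
  have \<theta>_hom: "module_hom (scal F) (scal F) \<theta>" and \<theta>_gr: "\<And>n. \<theta> ` gr F n \<subseteq> gr F (n - 1)"
    and leibniz: "\<And>n a b. a \<in> gr F n \<Longrightarrow> \<theta> (a * b) = \<theta> a * b + ksign (- n) (a * \<theta> b)"
    using \<theta>(1) by (auto simp: der_cycles_def gamma_derivations_def end_maps_def)
  interpret \<theta>: module_hom "scal F" "scal F" \<theta> by (rule \<theta>_hom)
  have \<theta>\<psi>_gr: "\<theta> (\<psi> g) \<in> gr F (n + (-1 + m))" if "g \<in> gr G n" for g n
    using \<theta>_gr[of "n + m"] \<psi>_gr[OF that] by (auto simp: algebra_simps image_subset_iff)
  have \<theta>\<psi>: "module_hom (scal G) (scal F) (\<lambda>g. \<theta> (\<psi> g))"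
    by unfold_locales (simp_all add: \<psi>.add \<theta>.add \<psi>.scale \<theta>.scale)
  obtain \<Psi> where \<Psi>: "\<Psi> \<in> homF G F m" "\<And>g f. \<Psi> (GF_tensor G F g f) = \<psi> g * f"
    using homF_of_module_hom[OF \<psi>(1,2)] by blast
  obtain X where X: "X \<in> homF G F (-1 + m)" "\<And>g f. X (GF_tensor G F g f) = \<theta> (\<psi> g) * f"
    using homF_of_module_hom[OF \<theta>\<psi>, of "-1 + m"] \<theta>\<psi>_gr by blast
  have "\<Psi> \<in> homF_cycles G F m"
    unfolding homF_cycles_def
  proof (intro CollectI conjI \<Psi>(1) allI impI)
    fix n g f assume "g \<in> gr G n"
    from bd_mult[OF \<psi>_gr[OF this], of f]
    show "bd F (\<Psi> (GF_tensor G F g f)) =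
       ksign m (\<Psi> (GF_tensor G F (bd G g) f) + ksign n (\<Psi> (GF_tensor G F g (bd F f))))"
      by (simp add: \<Psi>(2) \<psi>(3) ksign_mult_left) (simp add: ksign_def)
  qed
  moreover have "is_der_action G F (-1) \<theta> m \<Psi> X"
    unfolding is_der_action_def
  proof (intro conjI X(1) allI impI)
    \<comment> \<open>The Leibniz term with \<theta> on the second factor carries the sign of the
      degree m + n of \<open>\<psi> g\<close>, which is precisely the term that the action formula
      subtracts.\<close>
    fix n g f assume "g \<in> gr G n"
    from leibniz[OF \<psi>_gr[OF this], of f]
    show "X (GF_tensor G F g f) =
       \<theta> (\<Psi> (GF_tensor G F g f)) - ksign (-1 * (m + n)) (\<Psi> (GF_tensor G F g (\<theta> f)))"
      by (simp add: \<Psi>(2) X(2) add.commute)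
  qed
  moreover have "corresponds eps aug G F \<Psi> \<alpha>"
    using subsetD[OF tor_dual_deg_subset \<alpha>] \<psi>(4) \<Psi>(2) by (simp add: corresponds_def)
  moreover have "corresponds eps aug G F X \<beta>"
  proof -
    have \<beta>f: "\<beta> \<in> tor_functionals eps G"
      and \<beta>0: "\<And>n z. n + (m - 1) \<noteq> 0 \<Longrightarrow> z \<in> gr G n \<Longrightarrow> \<beta> (tor_bar eps G z) = 0"
      using \<beta> by (auto simp: tor_dual_deg_def)
    have "\<beta> (tor_bar eps G g) = aug (\<theta> (\<psi> g))" for g
    proof (induction g rule: G.homog_induct)
      case zero
      then show ?case
        by (simp add: tor_functional_bar_zero[OF \<beta>f] module_hom.zero[OF module_hom_aug])
    next
      case (add a b)
      then show ?case
        by (simp add: tor_functional_bar_add[OF \<beta>f] \<psi>.add \<theta>.add aug_add)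
    next
      case (homog n z)
      show ?case
      proof (cases "n = 1 - m")
        case True
        then have z: "z \<in> gr G (1 - m)" using homog by simp
        obtain f where "\<forall>j\<in>{1..e}. f j \<in> gr G (1 - m - 1)" "bd G z = (\<Sum>j=1..e. scal G (r j) (f j))"
          using bd_coords[OF z] by blast
        then have f: "\<And>j. j \<in> {1..e} \<Longrightarrow> f j \<in> gr G (- m)" "bd G z = (\<Sum>j=1..e. scal G (r j) (f j))"
          by simp_all
        show ?thesis
          using \<beta>_bar[OF z f] aug_derivation_lift[OF \<psi>(1-3) \<theta>_hom \<theta>(3) i z f] \<psi>(4) by simp
      next
        case False
        \<comment> \<open>Outside degree 1 - m both sides vanish: \<beta> because of its degree, the
          other side because \<open>aug\<close> is 0 off degree 0.\<close>
        then have "n + (m - 1) \<noteq> 0" "n + (-1 + m) \<noteq> 0" by simp_all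
        then show ?thesis using \<beta>0[OF _ homog] aug_gr[OF \<theta>\<psi>_gr[OF homog]] by simp
      qed
    qed
    then show ?thesis
      using subsetD[OF tor_dual_deg_subset \<beta>] X(2) by (simp add: corresponds_def)
  qed
  ultimately show ?thesis
    unfolding lie_acts_def using \<theta>(2) by blast
qed

end

section \<open>The extension algebra\<close>

context graded_complex
begin

section \<open>Cycles and boundaries under composition\<close>

abbreviation "fun_scal \<equiv> \<lambda>r \<phi> (a :: 'a). scal C r (\<phi> a :: 'a)"

lemma module_fun_scal: "module fun_scal"
  by unfold_locales (simp_all add: fun_eq_iff scale_left_distrib scale_right_distrib)

interpretation fs: module fun_scal
  by (rule module_fun_scal)

abbreviation "cycle_span \<equiv> fs.span (\<Union>d. end_cycles C d)"

lemma end_mapsD: "\<phi> \<in> end_maps C d \<Longrightarrow> module_hom (scal C) (scal C) \<phi>"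
    "\<phi> \<in> end_maps C d \<Longrightarrow> z \<in> gr C n \<Longrightarrow> \<phi> z \<in> gr C (n + d)"
  by (auto simp: end_maps_def)

lemma end_cycles_commute: "\<phi> \<in> end_cycles C d \<Longrightarrow> bd C (\<phi> a) = ksign d (\<phi> (bd C a))"
  by (simp add: end_cycles_def end_diff_def fun_eq_iff)

lemma end_maps_comp:
  assumes "\<phi> \<in> end_maps C d" "\<psi> \<in> end_maps C d'"
  shows "\<phi> \<circ> \<psi> \<in> end_maps C (d + d')"
proof -
  have "\<phi> (\<psi> z) \<in> gr C (n + (d + d'))" if "z \<in> gr C n" for n z
    using end_mapsD(2)[OF assms(1) end_mapsD(2)[OF assms(2) that]] by (simp add: algebra_simps)
  moreover have "module_hom (scal C) (scal C) (\<phi> \<circ> \<psi>)"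
    using assms by (intro module_hom_compose) (auto simp: end_maps_def)
  ultimately show ?thesis by (auto simp: end_maps_def)
qed

lemma end_diff_comp_cycle:
  assumes "\<phi> \<in> end_maps C d" "\<psi> \<in> end_cycles C d'"
  shows "end_diff C d \<phi> \<circ> \<psi> = end_diff C (d + d') (\<phi> \<circ> \<psi>)"
proof -
  interpret \<phi>: module_hom "scal C" "scal C" \<phi> using assms(1) by (rule end_mapsD)
  show ?thesis
    by (auto simp: end_diff_def fun_eq_iff end_cycles_commute[OF assms(2)] ksign_def \<phi>.neg)
qed

text \<open>Moving \<partial> past \<psi> costs the sign (-1)^d'. It is put inside the map so that
  the result is again literally of the form \<open>end_diff\<close>.\<close>

lemma cycle_comp_end_diff:
  assumes "\<phi> \<in> end_maps C d" "\<psi> \<in> end_cycles C d'"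
  shows "\<psi> \<circ> end_diff C d \<phi> = end_diff C (d' + d) (\<lambda>a. ksign d' (\<psi> (\<phi> a)))"
proof -
  interpret \<psi>: module_hom "scal C" "scal C" \<psi>
    using assms(2) by (auto simp: end_cycles_def end_maps_def)
  show ?thesis
    by (auto simp: end_diff_def fun_eq_iff end_cycles_commute[OF assms(2)] ksign_def \<psi>.neg \<psi>.diff bd.neg)
qed

lemma end_cycles_comp:
  assumes "\<phi> \<in> end_cycles C d" "\<psi> \<in> end_cycles C d'"
  shows "\<phi> \<circ> \<psi> \<in> end_cycles C (d + d')"
proof -
  have \<phi>: "\<phi> \<in> end_maps C d" "end_diff C d \<phi> = 0" and "\<psi> \<in> end_maps C d'"
    using assms by (auto simp: end_cycles_def)
  moreover have "end_diff C (d + d') (\<phi> \<circ> \<psi>) = 0"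
    using end_diff_comp_cycle[OF \<phi>(1) assms(2)] \<phi>(2) by (simp add: fun_eq_iff)
  ultimately show ?thesis
    by (simp add: end_cycles_def end_maps_comp)
qed

lemma end_maps_ksign:
  assumes "\<phi> \<in> end_maps C d"
  shows "(\<lambda>a. ksign n (\<phi> a)) \<in> end_maps C d"
proof -
  interpret \<phi>: module_hom "scal C" "scal C" \<phi> using assms by (rule end_mapsD)
  have "module_hom (scal C) (scal C) (\<lambda>a. ksign n (\<phi> a))"
    by unfold_locales (simp_all add: \<phi>.add \<phi>.scale module_scale_ksign[OF module_scal])
  then show ?thesis
    using ksign_mem[OF module_scal subspace_gr end_mapsD(2)[OF assms]] by (auto simp: end_maps_def)
qed

lemma end_diff_cycle:
  assumes "\<phi> \<in> end_maps C d"
  shows "end_diff C d \<phi> \<in> end_cycles C (d - 1)"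
proof -
  interpret \<phi>: module_hom "scal C" "scal C" \<phi> using assms by (rule end_mapsD)
  have "module_hom (scal C) (scal C) (end_diff C d \<phi>)"
    by unfold_locales (simp_all add: end_diff_def \<phi>.add \<phi>.scale bd.add bd.scale
        module_scale_ksign[OF module_scal] scale_right_diff_distrib)
  moreover have "end_diff C d \<phi> z \<in> gr C (n + (d - 1))" if z: "z \<in> gr C n" for n z
  proof -
    have "bd C (\<phi> z) \<in> gr C (n + d - 1)" "\<phi> (bd C z) \<in> gr C (n - 1 + d)"
      using bd_gr end_mapsD(2)[OF assms] z by blast+
    then show ?thesis
      unfolding end_diff_def
      by (intro subspace_diff[OF subspace_gr] ksign_mem[OF module_scal subspace_gr])
        (simp_all add: algebra_simps)
  qed
  moreover have "end_diff C (d - 1) (end_diff C d \<phi>) = 0"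
    by (auto simp: end_diff_def fun_eq_iff ksign_def bd.diff bd.neg bd_bd)
  ultimately show ?thesis by (auto simp: end_cycles_def end_maps_def)
qed

text \<open>Composition is bilinear, so membership in \<open>W\<close> may be checked on generators.
  Only the outer maps must be linear: composition is additive in the outer map by pointwise
  definition, but in the inner map only through linearity of the outer one.\<close>

lemma fun_scal_span_comp:
  assumes S: "\<And>\<phi>. \<phi> \<in> S \<Longrightarrow> module_hom (scal C) (scal C) \<phi>" and W: "fs.subspace W"
    and ST: "\<And>\<phi> \<psi>. \<phi> \<in> S \<Longrightarrow> \<psi> \<in> T \<Longrightarrow> \<phi> \<circ> \<psi> \<in> W"
    and \<phi>: "\<phi> \<in> fs.span S" and \<psi>: "\<psi> \<in> fs.span T"
  shows "\<phi> \<circ> \<psi> \<in> W"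
proof -
  have "\<phi> \<circ> \<psi> \<in> W" if \<phi>: "\<phi> \<in> S" for \<phi>
  proof -
    interpret \<phi>: module_hom "scal C" "scal C" \<phi> by (rule S[OF \<phi>])
    have eqs: "\<phi> \<circ> 0 = 0" "\<phi> \<circ> (f + g) = (\<phi> \<circ> f) + (\<phi> \<circ> g)" "\<phi> \<circ> fun_scal c f = fun_scal c (\<phi> \<circ> f)"
      for f g c
      by (simp_all add: fun_eq_iff \<phi>.add \<phi>.scale)
    have "fs.subspace {\<psi>. \<phi> \<circ> \<psi> \<in> W}"
      unfolding fs.subspace_def mem_Collect_eq eqs
      using fs.subspace_0[OF W] fs.subspace_add[OF W] fs.subspace_scale[OF W] by (simp add: o_def)
    then show ?thesis
      using fs.span_minimal[of T "{\<psi>. \<phi> \<circ> \<psi> \<in> W}"] ST[OF \<phi>] \<psi> by blast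
  qed
  moreover have "fs.subspace {\<phi>. \<phi> \<circ> \<psi> \<in> W}"
  proof -
    have eqs: "0 \<circ> \<psi> = 0" "(f + g) \<circ> \<psi> = (f \<circ> \<psi>) + (g \<circ> \<psi>)" "fun_scal c f \<circ> \<psi> = fun_scal c (f \<circ> \<psi>)"
      for f g c
      by (simp_all add: fun_eq_iff)
    show ?thesis
      unfolding fs.subspace_def mem_Collect_eq eqs
      using fs.subspace_0[OF W] fs.subspace_add[OF W] fs.subspace_scale[OF W] by (simp add: o_def)
  qed
  ultimately show ?thesis
    using fs.span_minimal[of S "{\<phi>. \<phi> \<circ> \<psi> \<in> W}"] \<phi> by blast
qed

lemma subspace_end_boundaries: "fs.subspace (end_boundaries C)"
  by (simp add: end_boundaries_def)

lemma end_diff_boundary: "\<phi> \<in> end_maps C d \<Longrightarrow> end_diff C d \<phi> \<in> end_boundaries C"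
  unfolding end_boundaries_def by (rule fs.span_base) blast

lemma end_cycles_hom: "\<phi> \<in> (\<Union>d. end_cycles C d) \<Longrightarrow> module_hom (scal C) (scal C) \<phi>"
  by (auto simp: end_cycles_def end_maps_def)

lemma cycle_span_hom:
  assumes "\<phi> \<in> cycle_span"
  shows "module_hom (scal C) (scal C) \<phi>"
proof -
  have "fs.subspace {\<phi>. module_hom (scal C) (scal C) \<phi>}"
    by (simp add: fs.subspace_def module_hom_iff module_scal scale_right_distrib mult.commute)
  then have "cycle_span \<subseteq> {\<phi>. module_hom (scal C) (scal C) \<phi>}"
    using end_cycles_hom by (intro fs.span_minimal) blast+
  then show ?thesis using assms by blast
qed

lemma end_boundaries_subset: "end_boundaries C \<subseteq> cycle_span"
  unfolding end_boundaries_def using end_diff_cycle by (intro fs.span_mono) blast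

lemma cycle_span_comp: "\<phi> \<in> cycle_span \<Longrightarrow> \<psi> \<in> cycle_span \<Longrightarrow> \<phi> \<circ> \<psi> \<in> cycle_span"
  by (rule fun_scal_span_comp[OF end_cycles_hom fs.subspace_span])
    (auto intro: fs.span_base end_cycles_comp)

lemma cycle_comp_boundary: "\<phi> \<in> cycle_span \<Longrightarrow> \<psi> \<in> end_boundaries C \<Longrightarrow> \<phi> \<circ> \<psi> \<in> end_boundaries C"
proof (rule fun_scal_span_comp[OF end_cycles_hom subspace_end_boundaries])
  fix \<phi> \<psi> assume "\<phi> \<in> (\<Union>d. end_cycles C d)" "\<psi> \<in> (\<Union>d. end_diff C d ` end_maps C d)"
  then obtain d' d \<psi>' where *: "\<phi> \<in> end_cycles C d'" "\<psi>' \<in> end_maps C d" "\<psi> = end_diff C d \<psi>'" by blast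
  have "\<phi> \<circ> \<psi>' \<in> end_maps C (d' + d)"
    using * by (intro end_maps_comp) (simp_all add: end_cycles_def)
  from end_diff_boundary[OF end_maps_ksign[OF this, of d']] show "\<phi> \<circ> \<psi> \<in> end_boundaries C"
    unfolding *(3) cycle_comp_end_diff[OF *(2,1)] by simp
qed (simp_all add: end_boundaries_def)

lemma boundary_comp_cycle: "\<phi> \<in> end_boundaries C \<Longrightarrow> \<psi> \<in> cycle_span \<Longrightarrow> \<phi> \<circ> \<psi> \<in> end_boundaries C"
proof (rule fun_scal_span_comp[where S = "\<Union>d. end_diff C d ` end_maps C d", OF _ subspace_end_boundaries])
  show "module_hom (scal C) (scal C) \<phi>" if "\<phi> \<in> (\<Union>d. end_diff C d ` end_maps C d)" for \<phi>
    using that end_diff_cycle by (intro end_cycles_hom) blast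
  fix \<phi> \<psi> assume "\<phi> \<in> (\<Union>d. end_diff C d ` end_maps C d)" "\<psi> \<in> (\<Union>d. end_cycles C d)"
  then obtain d d' \<phi>' where *: "\<psi> \<in> end_cycles C d'" "\<phi>' \<in> end_maps C d" "\<phi> = end_diff C d \<phi>'" by blast
  have "\<phi>' \<circ> \<psi> \<in> end_maps C (d + d')"
    using * by (intro end_maps_comp) (simp_all add: end_cycles_def)
  from end_diff_boundary[OF this] show "\<phi> \<circ> \<psi> \<in> end_boundaries C"
    unfolding *(3) end_diff_comp_cycle[OF *(2,1)] .
qed (simp_all add: end_boundaries_def)

lemma end_class_eq_iff: "end_class C \<phi> = end_class C \<psi> \<longleftrightarrow> \<phi> - \<psi> \<in> end_boundaries C"
  unfolding end_class_def by (rule coset_eq_iff[OF module_fun_scal subspace_end_boundaries])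

lemma end_boundaries_plus: "end_boundaries C + end_boundaries C = end_boundaries C"
  by (rule subspace_set_plus[OF module_fun_scal subspace_end_boundaries])

lemma end_class_add: "end_class C (\<phi> + \<psi>) = end_class C \<phi> + end_class C \<psi>"
  by (simp add: end_class_def set_plus_rearrange end_boundaries_plus)

text \<open>The product of classes is well defined since boundaries form a two-sided ideal among the
  cycles: fg - \<phi>\<psi> = (f - \<phi>)g + \<phi>(g - \<psi>).\<close>

lemma ext_mult_end_class:
  assumes "\<phi> \<in> cycle_span" "\<psi> \<in> cycle_span"
  shows "ext_mult C (end_class C \<phi>) (end_class C \<psi>) = end_class C (\<phi> \<circ> \<psi>)"
proof
  have "f \<circ> g \<in> end_class C (\<phi> \<circ> \<psi>)" if fg: "f \<in> end_class C \<phi>" "g \<in> end_class C \<psi>" for f g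
  proof -
    have f: "f - \<phi> \<in> end_boundaries C" and g: "g - \<psi> \<in> end_boundaries C"
      using fg by (simp_all add: end_class_def set_minus_plus)
    have "(g - \<psi>) + \<psi> \<in> cycle_span"
      by (rule fs.span_add[OF subsetD[OF end_boundaries_subset g] assms(2)])
    then have "g \<in> cycle_span" by simp
    then have "(f - \<phi>) \<circ> g \<in> end_boundaries C"
      by (rule boundary_comp_cycle[OF f])
    moreover have "\<phi> \<circ> (g - \<psi>) \<in> end_boundaries C"
      by (rule cycle_comp_boundary[OF assms(1) g])
    ultimately have "((f - \<phi>) \<circ> g) + (\<phi> \<circ> (g - \<psi>)) \<in> end_boundaries C"
      by (rule fs.subspace_add[OF subspace_end_boundaries])
    moreover have "((f - \<phi>) \<circ> g) + (\<phi> \<circ> (g - \<psi>)) = (f \<circ> g) - (\<phi> \<circ> \<psi>)"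
    proof -
      have "module_hom (scal C) (scal C) \<phi>" by (rule cycle_span_hom[OF assms(1)])
      then show ?thesis by (simp add: fun_eq_iff module_hom.diff)
    qed
    ultimately show ?thesis by (simp add: end_class_def set_minus_plus)
  qed
  then have "{f \<circ> g | f g. f \<in> end_class C \<phi> \<and> g \<in> end_class C \<psi>} \<subseteq> end_class C (\<phi> \<circ> \<psi>)"
    by blast
  then have "ext_mult C (end_class C \<phi>) (end_class C \<psi>) \<subseteq> end_class C (\<phi> \<circ> \<psi>) + end_boundaries C"
    unfolding ext_mult_def by (rule set_plus_mono2) simp
  then show "ext_mult C (end_class C \<phi>) (end_class C \<psi>) \<subseteq> end_class C (\<phi> \<circ> \<psi>)"
    by (simp add: end_class_def set_plus_rearrange3 end_boundaries_plus)
  have "f \<in> end_class C f" for f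
    using set_plus_intro2[OF fs.subspace_0[OF subspace_end_boundaries], of f] by (simp add: end_class_def)
  then have "\<phi> \<circ> \<psi> \<in> {f \<circ> g | f g. f \<in> end_class C \<phi> \<and> g \<in> end_class C \<psi>}" by blast
  then show "end_class C (\<phi> \<circ> \<psi>) \<subseteq> ext_mult C (end_class C \<phi>) (end_class C \<psi>)"
    unfolding ext_mult_def end_class_def[of C "\<phi> \<circ> \<psi>"] by (rule set_plus_mono3)
qed

lemma scal_end_cycle: "scal C c \<in> end_cycles C 0"
proof -
  have "module_hom (scal C) (scal C) (scal C c)"
    by (rule module_hom_scale_self)
  moreover have "end_diff C 0 (scal C c) = 0"
    by (simp add: end_diff_def fun_eq_iff bd.scale ksign_def)
  ultimately show ?thesis
    by (auto simp: end_cycles_def end_maps_def intro: subspace_scale[OF subspace_gr])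
qed

lemma end_cycles_in_span: "\<phi> \<in> end_cycles C d \<Longrightarrow> \<phi> \<in> cycle_span"
  by (rule fs.span_base) blast

text \<open>Makes the restriction meaningful: the laws of \<open>ext_act\<close> are stated over
  \<open>ext_alg\<close> and must be available on \<open>ext_shriek\<close>.\<close>

lemma ext_shriek_subset: "ext_shriek C \<subseteq> ext_alg C"
proof
  fix X assume "X \<in> ext_shriek C"
  then show "X \<in> ext_alg C"
  proof induction
    case (scalar a)
    then show ?case
      unfolding ext_alg_def ext_scalar_def by (intro imageI end_cycles_in_span[OF scal_end_cycle])
  next
    case (gen X)
    then show ?case
      unfolding ext_alg_def ext_deg_def using end_cycles_in_span by blast
  next
    case (add X Y)
    then show ?case
      unfolding ext_alg_def by (auto simp: end_class_add[symmetric] intro: fs.span_add)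
  next
    case (mult X Y)
    then show ?case
      unfolding ext_alg_def by (auto simp: ext_mult_end_class intro: cycle_span_comp)
  qed
qed

end

text \<open>Subtracting the combination of the \<open>\<theta> i\<close> with the same values on the
  variables of degree 1 leaves a cycle \<open>u\<close> that vanishes on all of degree 1. This
  removes the only obstruction to a null homotopy.\<close>

lemma (in residue_resolution) ext_deg_one_eq:
  assumes \<theta>: "\<And>i. i \<in> {1..e} \<Longrightarrow> \<theta> i \<in> der_cycles F (-1)"
    "\<And>i j. i \<in> {1..e} \<Longrightarrow> j \<in> {1..e} \<Longrightarrow> \<theta> i (var F (x j)) = (if i = j then 1 else 0)"
    and X: "X \<in> ext_deg F (-1)"
  shows "\<exists>a. X = end_class F (\<Sum>i=1..e. scal F (a i) \<circ> \<theta> i)"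
proof -
  obtain \<phi> where \<phi>: "\<phi> \<in> end_cycles F (-1)" "X = end_class F \<phi>"
    using X by (auto simp: ext_deg_def)
  have \<phi>_gr: "\<phi> z \<in> gr F (n - 1)" if "z \<in> gr F n" for z n
    using \<phi>(1) that by (auto simp: end_cycles_def end_maps_def)
  have \<phi>_hom: "module_hom (scal F) (scal F) \<phi>"
    using \<phi>(1) by (auto simp: end_cycles_def end_maps_def)
  have \<theta>_cycle: "\<theta> i \<in> end_cycles F (-1)" if "i \<in> {1..e}" for i
    using \<theta>(1)[OF that] by (auto simp: der_cycles_def gamma_derivations_def end_cycles_def)
  have \<theta>_hom: "module_hom (scal F) (scal F) (\<theta> i)" if "i \<in> {1..e}" for i
    using \<theta>_cycle[OF that] by (auto simp: end_cycles_def end_maps_def)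
  have \<theta>_gr: "\<theta> i z \<in> gr F (n - 1)" if "i \<in> {1..e}" "z \<in> gr F n" for i z n
    using \<theta>_cycle[OF that(1)] that(2) by (auto simp: end_cycles_def end_maps_def)
  have "\<forall>i\<in>{1..e}. \<exists>c. \<phi> (var F (x i)) = scal F c 1"
    using \<phi>_gr[OF x_gr] gr_0_eq by fastforce
  \<comment> \<open>The coefficients are the values of \<phi> on the variables of degree 1; these
    lie in degree 0, that is, in the ring.\<close>
  then obtain a where a: "\<And>i. i \<in> {1..e} \<Longrightarrow> \<phi> (var F (x i)) = scal F (a i) 1" by metis
  define u where "u z = \<phi> z - (\<Sum>i=1..e. scal F (a i) (\<theta> i z))" for z
  have u_hom: "module_hom (scal F) (scal F) u"
  proof
    show "u (b + c) = u b + u c" for b c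
    proof -
      have "(\<Sum>i=1..e. scal F (a i) (\<theta> i (b + c))) = (\<Sum>i=1..e. scal F (a i) (\<theta> i b) + scal F (a i) (\<theta> i c))"
        by (intro sum.cong) (simp_all add: module_hom.add[OF \<theta>_hom] scale_right_distrib)
      then show ?thesis by (simp add: u_def module_hom.add[OF \<phi>_hom] sum.distrib)
    qed
    show "u (scal F c b) = scal F c (u b)" for c b
    proof -
      have "(\<Sum>i=1..e. scal F (a i) (\<theta> i (scal F c b))) = (\<Sum>i=1..e. scal F c (scal F (a i) (\<theta> i b)))"
        by (intro sum.cong) (simp_all add: module_hom.scale[OF \<theta>_hom] mult.commute)
      then show ?thesis
        by (simp add: u_def module_hom.scale[OF \<phi>_hom] scale_right_diff_distrib scale_sum_right)
    qed
  qed
  have u_x: "u (var F (x j)) = 0" if j: "j \<in> {1..e}" for j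
  proof -
    have "(\<Sum>i=1..e. scal F (a i) (\<theta> i (var F (x j)))) = (\<Sum>i=1..e. if i = j then scal F (a i) 1 else 0)"
      using j by (intro sum.cong) (auto simp: \<theta>(2))
    then show ?thesis using j by (simp add: u_def a)
  qed
  have u_1: "u z = 0" if z: "z \<in> gr F 1" for z
  proof -
    obtain c where "z = (\<Sum>j=1..e. scal F (c j) (var F (x j)))" using gr_1_coords[OF z] by blast
    then show ?thesis
      by (simp add: module_hom.sum[OF u_hom] module_hom.scale[OF u_hom] u_x)
  qed
  have u_gr: "u z \<in> gr F (n - 1)" if "z \<in> gr F n" for z n
    unfolding u_def using that
    by (intro subspace_diff[OF subspace_gr] subspace_sum[OF subspace_gr] subspace_scale[OF subspace_gr]
        \<phi>_gr \<theta>_gr) auto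
  have u_bd: "bd F (u z) + u (bd F z) = 0" for z
  proof -
    have "(\<Sum>i=1..e. scal F (a i) (bd F (\<theta> i z))) = (\<Sum>i=1..e. - scal F (a i) (\<theta> i (bd F z)))"
      by (intro sum.cong) (simp_all add: end_cycles_commute[OF \<theta>_cycle] ksign_def)
    then show ?thesis
      by (simp add: u_def bd.diff bd.sum bd.scale end_cycles_commute[OF \<phi>(1)] ksign_def sum_negf)
  qed
  \<comment> \<open>The homotopy starts with 0 on degree 0. The first boundary condition then asks
    only that \<open>u\<close> map degree 1 to boundaries, and it is 0 there. The equation reads u =
    \<partial>h - h\<partial>.\<close>
  have "\<exists>h. module_hom (scal F) (scal F) h \<and> (\<forall>n. h ` gr F n \<subseteq> gr F (n + 0)) \<and>
     (\<forall>z. bd F (h z) = u z + ksign 0 (h (bd F z))) \<and> (\<forall>z\<in>gr F (- 0). h z = 0)"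
  proof (rule chain_lift[OF graded_complex_axioms graded_complex_axioms free_gr acyclic u_hom])
    show "u z + ksign 0 0 \<in> bd F ` gr F 1" if "z \<in> gr F (1 - 0)" for z
      using u_1 that gr_0 by (auto intro!: image_eqI[of _ _ 0])
  qed (use u_gr u_bd in \<open>auto simp: ksign_def linear_on_def gr_0\<close>)
  then obtain h where "h \<in> end_maps F 0" "\<And>z. bd F (h z) = u z + h (bd F z)"
    by (auto simp: end_maps_def ksign_def)
  then have "u \<in> end_boundaries F"
    using end_diff_boundary[of h 0] by (simp add: end_diff_def ksign_def)
  moreover have "u = \<phi> - (\<Sum>i=1..e. scal F (a i) \<circ> \<theta> i)"
    by (simp add: fun_eq_iff u_def sum_fun_apply)
  ultimately show ?thesis
    unfolding \<phi>(2) by (intro exI[of _ a]) (simp add: end_class_eq_iff)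
qed

section \<open>Comparison of the two actions\<close>

context residue_resolution
begin

lemma zero_gamma_derivation: "0 \<in> gamma_derivations F d"
  by (auto simp: gamma_derivations_def end_maps_def gr_0 zero_fun_def
      intro: module_pair.module_hom_zero module_pair.intro module_scal)

text \<open>Passes from a derivation to its class in Ext by way of its Lie class. Boundaries of
  derivations contain 0 and are boundaries in the endomorphism complex, so adding
  \<open>end_boundaries F\<close> absorbs them.\<close>

lemma homotopy_class:
  assumes "\<theta> \<in> der_cycles F d"
  shows "\<exists>\<xi>\<in>homotopy_lie F d. \<theta> \<in> \<xi> \<and> \<xi> + end_boundaries F = end_class F \<theta>"
proof -
  let ?D = "end_diff F (d + 1) ` gamma_derivations F (d + 1)"
  have "end_diff F (d + 1) 0 = 0" by (simp add: end_diff_def fun_eq_iff bd.zero)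
  then have D0: "0 \<in> ?D" using zero_gamma_derivation by (metis image_eqI)
  have "?D \<subseteq> end_boundaries F"
    using end_diff_boundary by (auto simp: gamma_derivations_def)
  then have "?D + end_boundaries F \<subseteq> end_boundaries F"
    using set_plus_mono2[of ?D "end_boundaries F" "end_boundaries F" "end_boundaries F"]
    by (simp add: end_boundaries_plus)
  moreover have "end_boundaries F \<subseteq> ?D + end_boundaries F"
    by (rule set_zero_plus2[OF D0])
  ultimately have "?D + end_boundaries F = end_boundaries F" by (rule equalityI)
  then have "(\<theta> +o ?D) + end_boundaries F = end_class F \<theta>"
    by (simp add: set_plus_rearrange3 end_class_def)
  moreover have "\<theta> \<in> \<theta> +o ?D" using set_plus_intro2[OF D0, of \<theta>] by simp
  ultimately show ?thesis
    using assms by (intro bexI[of _ "\<theta> +o ?D"]) (simp_all add: homotopy_lie_def)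
qed

lemma der_cycles_subset: "der_cycles F d \<subseteq> end_cycles F d"
  by (auto simp: der_cycles_def gamma_derivations_def end_cycles_def)

lemma left_action_add:
  assumes "left_action eps G F A act" "X \<in> A"
  shows "\<forall>\<alpha>\<in>tor_dual eps G. \<forall>\<beta>\<in>tor_dual eps G. act X (\<alpha> + \<beta>) = act X \<alpha> + act X \<beta>"
  using assms unfolding left_action_def by (elim conjE) (erule bspec)

text \<open>The classes of the \<open>\<theta> i\<close> and the scalars generate
  \<open>ext_shriek\<close>, so two module structures that agree on these classes for homogeneous
  functionals agree throughout.\<close>

lemma left_actions_agree:
  assumes act: "left_action eps G F (ext_alg F) act" "left_action eps G F (ext_shriek F) act'"
    and \<theta>: "\<And>i. i \<in> {1..e} \<Longrightarrow> \<theta> i \<in> der_cycles F (-1)"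
      "\<And>i j. i \<in> {1..e} \<Longrightarrow> j \<in> {1..e} \<Longrightarrow> \<theta> i (var F (x j)) = (if i = j then 1 else 0)"
    and eq: "\<And>i m \<alpha>. i \<in> {1..e} \<Longrightarrow> \<alpha> \<in> tor_dual_deg eps G m \<Longrightarrow>
      act (end_class F (\<theta> i)) \<alpha> = act' (end_class F (\<theta> i)) \<alpha>"
    and X: "X \<in> ext_shriek F" and \<alpha>: "\<alpha> \<in> tor_dual eps G"
  shows "act X \<alpha> = act' X \<alpha>"
proof -
  \<comment> \<open>Membership in \<open>ext_shriek\<close> is carried along so that the laws of
    both actions apply at each step of the induction.\<close>
  define same where "same X \<longleftrightarrow> X \<in> ext_shriek F \<and> (\<forall>\<alpha>\<in>tor_dual eps G. act X \<alpha> = act' X \<alpha>)" for X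
  have in_alg: "X \<in> ext_alg F" if "X \<in> ext_shriek F" for X
    using that ext_shriek_subset by (rule subsetD[rotated])
  \<comment> \<open>In a product the inner factor acts first; its value must again lie in
    \<open>tor_dual\<close> before the equality for the outer factor can be used.\<close>
  have closed: "act' X \<alpha> \<in> tor_dual eps G" if "X \<in> ext_shriek F" "\<alpha> \<in> tor_dual eps G" for X \<alpha>
    using act(2) that by (simp add: left_action_def)
  have same_scalar: "same (ext_scalar F a)" for a
    using act by (simp add: same_def left_action_def ext_shriek.scalar)
  have same_add: "same (X + Y)" if "same X" "same Y" for X Y
    using act that in_alg by (simp add: same_def left_action_def ext_shriek.add)
  have same_mult: "same (ext_mult F X Y)" if "same X" "same Y" for X Y
    using act that in_alg closed by (simp add: same_def left_action_def ext_shriek.mult)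
  have \<theta>_cycle: "\<theta> i \<in> end_cycles F (-1)" if "i \<in> {1..e}" for i
    using \<theta>(1)[OF that] der_cycles_subset by (rule subsetD[rotated])
  have same_y: "same (end_class F (\<theta> i))" if i: "i \<in> {1..e}" for i
  proof -
    have y: "end_class F (\<theta> i) \<in> ext_shriek F"
      by (rule ext_shriek.gen) (simp add: ext_deg_def \<theta>_cycle[OF i])
    have "act (end_class F (\<theta> i)) \<alpha> = act' (end_class F (\<theta> i)) \<alpha>" if \<alpha>: "\<alpha> \<in> tor_dual eps G" for \<alpha>
      by (rule tor_dual_map_eqI[OF residue G.graded_complex_axioms
          left_action_add[OF act(1) in_alg[OF y]] left_action_add[OF act(2) y] _ \<alpha>])
        (rule eq[OF i])
    with y show ?thesis by (simp add: same_def)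
  qed
  have "same (end_class F (\<Sum>i\<in>I. scal F (a i) \<circ> \<theta> i))" if "finite I" "I \<subseteq> {1..e}" for I a
    using that
  proof (induction I rule: finite_induct)
    case empty
    \<comment> \<open>The empty sum is the class of the scalar 0, on which the two actions agree by
      the scalar law.\<close>
    have "scal F 0 = 0" by (simp add: fun_eq_iff)
    then have "end_class F (\<Sum>i\<in>{}. scal F (a i) \<circ> \<theta> i) = ext_scalar F 0"
      by (simp only: ext_scalar_def sum.empty)
    then show ?case by (simp only: same_scalar)
  next
    case (insert i I)
    have "end_class F (scal F (a i) \<circ> \<theta> i) = ext_mult F (ext_scalar F (a i)) (end_class F (\<theta> i))"
      unfolding ext_scalar_def using insert.prems \<theta>_cycle
      by (intro ext_mult_end_class[symmetric] end_cycles_in_span[OF scal_end_cycle] end_cycles_in_span) auto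
    moreover have "(\<Sum>j\<in>insert i I. scal F (a j) \<circ> \<theta> j) =
        (scal F (a i) \<circ> \<theta> i) + (\<Sum>j\<in>I. scal F (a j) \<circ> \<theta> j)"
      using insert.hyps by (rule sum.insert)
    moreover have "same (end_class F (\<Sum>j\<in>I. scal F (a j) \<circ> \<theta> j))" "i \<in> {1..e}"
      using insert.IH insert.prems by blast+
    ultimately show ?case
      by (simp only: end_class_add same_add same_mult same_scalar same_y)
  qed
  then have same_gen: "same X" if "X \<in> ext_deg F (-1)" for X
    using ext_deg_one_eq[of \<theta>, OF \<theta> that] by auto
  from X have "same X"
    by induction (auto intro: same_scalar same_gen same_add same_mult)
  then show ?thesis using \<alpha> by (simp add: same_def)
qed

end

theorem proposition4p3:
  fixes mm :: "'r::comm_ring_1 set"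
    and eps :: "'r \<Rightarrow> 'k::field"
    and F :: "('r, 'f::ring_1, 'v::linorder) gamma_data"
    and aug :: "'f \<Rightarrow> 'k"
    and sM :: "'r \<Rightarrow> 'm::ab_group_add \<Rightarrow> 'm"
    and G :: "('r, 'g::ab_group_add) complex_data"
    and eta :: "'g \<Rightarrow> 'm"
    and e :: nat and r :: "nat \<Rightarrow> 'r" and x :: "nat \<Rightarrow> 'v" and \<theta> :: "nat \<Rightarrow> 'f \<Rightarrow> 'f"
    and ext_act hi_left ::
      "('f \<Rightarrow> 'f) set \<Rightarrow> (('g \<times> 'k \<Rightarrow>\<^sub>0 'r) set \<Rightarrow> 'k) \<Rightarrow> (('g \<times> 'k \<Rightarrow>\<^sub>0 'r) set \<Rightarrow> 'k)"
    and hi_right ::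
      "(('g \<times> 'k \<Rightarrow>\<^sub>0 'r) set \<Rightarrow> 'k) \<Rightarrow> ('f \<Rightarrow> 'f) set \<Rightarrow> (('g \<times> 'k \<Rightarrow>\<^sub>0 'r) set \<Rightarrow> 'k)"
  assumes "local_noetherian_ring mm"
    and "residue_field mm eps"
    and "acyclic_closure mm F"
    and "augmentation eps F aug"
    and "minimal_free_resolution mm sM G eta"
    and "minimal_generators mm e r"
    and "bij_betw x {1..e} {v \<in> Vars F. vdeg F v = 1}"
    and "\<forall>i\<in>{1..e}. bd F (var F (x i)) = scal F (r i) 1"
    and "\<forall>i\<in>{1..e}. \<theta> i \<in> der_cycles F (-1)"
    and "\<forall>i\<in>{1..e}. \<forall>j\<in>{1..e}. \<theta> i (var F (x j)) = (if i = j then 1 else 0)"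
    and "extended_lie_action eps aug G F ext_act"
    and "herzog_iyengar_right eps G F e r (\<lambda>i. end_class F (\<theta> i)) hi_right"
    and "herzog_iyengar_left eps G F e (\<lambda>i. end_class F (\<theta> i)) hi_right hi_left"
  shows "\<forall>X\<in>ext_shriek F. \<forall>\<alpha>\<in>tor_dual eps G. ext_act X \<alpha> = hi_left X \<alpha>"
proof -
  note G = \<open>minimal_free_resolution mm sM G eta\<close>[unfolded minimal_free_resolution_def]
  have "nonneg_complex G"
    using G by (elim conjE)
  have free: "\<forall>n. free_submodule (scal G) (gr G n)"
    using G by (elim conjE)
  have min: "range (bd G) \<subseteq> module.span (scal G) {scal G a z | a z. a \<in> mm}"
    using G by (elim conjE)
  interpret residue_resolution mm F G eps aug e r x
  proof (intro residue_resolution.intro acyclic_closure_of.intro graded_complex.intro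
      residue_resolution_axioms.intro)
    show "bd G z \<in> module.span (scal G) {scal G a z | a z. a \<in> mm}" for z
      using min by (rule subsetD) (rule rangeI)
  qed (fact | use assms(8) free in blast)+
  note \<theta> = \<open>\<forall>i\<in>{1..e}. \<theta> i \<in> der_cycles F (-1)\<close>[rule_format]
    \<open>\<forall>i\<in>{1..e}. \<forall>j\<in>{1..e}. \<theta> i (var F (x j)) = (if i = j then 1 else 0)\<close>[rule_format]
  note ext = assms(11)[unfolded extended_lie_action_def]
  note right = assms(12)[unfolded herzog_iyengar_right_def]
  note left = assms(13)[unfolded herzog_iyengar_left_def]
  have y_eq: "ext_act (end_class F (\<theta> i)) \<alpha> = hi_left (end_class F (\<theta> i)) \<alpha>"
    if i: "i \<in> {1..e}" and \<alpha>: "\<alpha> \<in> tor_dual_deg eps G m" for i m \<alpha>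
  proof -
    \<comment> \<open>The Herzog-Iyengar value is taken as candidate for the result of the Lie
      action; once \<open>lie_acts\<close> holds for it, the extension property forces
      \<open>ext_act\<close> to take this value.\<close>
    let ?y = "end_class F (\<theta> i)" and ?\<beta> = "hi_left (end_class F (\<theta> i)) \<alpha>"
    obtain \<xi> where \<xi>: "\<xi> \<in> homotopy_lie F (-1)" "\<theta> i \<in> \<xi>" "\<xi> + end_boundaries F = ?y"
      using homotopy_class[OF \<theta>(1)[OF i]] by blast
    have y: "?y \<in> ext_deg F (-1)"
      unfolding ext_deg_def using der_cycles_subset \<theta>(1)[OF i] by (intro imageI) (rule subsetD)
    have "\<forall>d m. \<forall>X\<in>ext_shriek F \<inter> ext_deg F d. \<forall>\<alpha>\<in>tor_dual_deg eps G m.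
        hi_left X \<alpha> \<in> tor_dual_deg eps G (d + m)"
      using conjunct1[OF left] unfolding left_action_def by (elim conjE)
    from bspec[OF bspec[OF spec[OF spec[OF this]] IntI[OF ext_shriek.gen[OF y] y]] \<alpha>]
    have \<beta>: "?\<beta> \<in> tor_dual_deg eps G (m - 1)" by simp
    have left_eq: "?\<beta> = - ksign m (hi_right \<alpha> ?y)"
      by (rule bspec[OF spec[OF bspec[OF conjunct2[OF left] i]] \<alpha>])
    have right_eq: "hi_right \<alpha> ?y (tor_bar eps G z) = - \<alpha> (tor_bar eps G (f i))"
      if "z \<in> gr G (1 - m)" "\<And>j. j \<in> {1..e} \<Longrightarrow> f j \<in> gr G (- m)" "bd G z = (\<Sum>j=1..e. scal G (r j) (f j))"
      for z f
    proof -
      \<comment> \<open>The right action is prescribed on functionals of degree 1 - n; here n = 1 -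
        m.\<close>
      have "\<alpha> \<in> tor_dual_deg eps G (1 - (1 - m))" using \<alpha> by simp
      note * = bspec[OF spec[OF spec[OF spec[OF bspec[OF conjunct2[OF right] i],
        of "1 - m"], of z], of f] this]
      show ?thesis by (rule mp[OF *]) (use that in simp)
    qed
    \<comment> \<open>The antipode contributes -(-1)^m and the right action another minus sign, so
      (-1)^m remains.\<close>
    have \<beta>_bar: "?\<beta> (tor_bar eps G z) = ksign m (\<alpha> (tor_bar eps G (f i)))"
      if "z \<in> gr G (1 - m)" "\<And>j. j \<in> {1..e} \<Longrightarrow> f j \<in> gr G (- m)" "bd G z = (\<Sum>j=1..e. scal G (r j) (f j))"
      for z f
      unfolding left_eq using right_eq[OF that] by (simp add: ksign_def)
    have "lie_acts eps aug G F (-1) \<xi> \<alpha> ?\<beta>"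
      by (rule lie_acts_degree_one[OF \<theta>(1)[OF i] \<xi>(2) \<theta>(2)[OF i] i \<alpha> \<beta>])
        (assumption | rule \<beta>_bar)+
    then have "ext_act (\<xi> + end_boundaries F) \<alpha> = ?\<beta>"
      using conjunct2[OF ext] \<xi>(1) by blast
    then show ?thesis by (simp only: \<xi>(3))
  qed
  show ?thesis
    by (intro ballI, rule left_actions_agree[OF conjunct1[OF ext] conjunct1[OF left] \<theta>])
      (assumption | rule y_eq)+
qed

end
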